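(* Let $(W,S)$ be a Coxeter system with a realization in a real vector space $V$, with closed Weyl chamber $\overline C$. If a closed family $(B(\lambda))_{\lambda\in\overline C}$ of highest weight normal continuous crystals ($B(\lambda)$ being of highest weight $\lambda$) exists, then it is unique: if $(B(\lambda))_{\lambda\in\overline C}$ and $(B'(\lambda))_{\lambda\in\overline C}$ are two such families, then $B(\lambda)$ and $B'(\lambda)$ are isomorphic continuous crystals for every $\lambda\in\overline C$.
   Context: **Realization.** A Coxeter system $(W,S)$: $W$ is a group generated by a finite set $S$ of involutions such that, if $m(s,s')$ is the order of $ss'$, the relations $(ss')^{m(s,s')}=1$ for $m(s,s')$ finite give a presentation of $W$. A realization is given by a real vector space $V$ with dual $V^\vee$, an action of $W$ on $V$, and a subset $\{(\alpha_s,\alpha_s^\vee),s\in S\}$ of $V\times V^\vee$ such that each $s\in S$ acts on $V$ by the reflection $s(x)=x-\alpha_s^\vee(x)\alpha_s$ (so $\alpha_s^\vee(\alpha_s)=2$). $\Sigma=\{\alpha_s,s\in S\}$ is the set of simple roots; for $\alpha=\alpha_s$ write $\alpha^\vee=\alpha_s^\vee$. $\overline C=\{v\in V:\alpha_s^\vee(v)\ge0\ \forall s\in S\}$. **Continuous crystal.** A set $B$ with maps $wt:B\to V$, $\varepsilon_\alpha,\varphi_\alpha:B\to\mathbb R\cup\{-\infty\}$ and $e_\alpha^r:B\cup\{\mathbf 0\}\to B\cup\{\mathbf 0\}$ ($\alpha\in\Sigma$, $r\in\mathbb R$; $\mathbf 0$ a ghost element not in $B$) such that for all $\alpha\in\Sigma,b\in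 B$: (C1) $\varphi_\alpha(b)=\varepsilon_\alpha(b)+\alpha^\vee(wt(b))$; (C2) if $e_\alpha^r(b)\ne\mathbf 0$ then $\varepsilon_\alpha(e_\alpha^rb)=\varepsilon_\alpha(b)-r$, $\varphi_\alpha(e_\alpha^rb)=\varphi_\alpha(b)+r$, $wt(e_\alpha^rb)=wt(b)+r\alpha$; (C3) $e_\alpha^r(\mathbf 0)=\mathbf 0$, $e_\alpha^0(b)=b$, and if $e_\alpha^r(b)\neq\mathbf 0$ then $e_\alpha^{s+r}(b)=e_\alpha^s(e_\alpha^r(b))$ for all $s\in\mathbb R$; (C4) if $\varphi_\alpha(b)=-\infty$ then $e_\alpha^r(b)=\mathbf 0$ for all $r\ne0$. For $r\ge0$ put $f_\alpha^r=e_\alpha^{-r}$. **Normal.** $B$ is normal if for all $b\in B$, $\alpha\in\Sigma$: $\varepsilon_\alpha(b)=\max\{r\ge0:e_\alpha^r(b)\ne\mathbf 0\}$ and $\varphi_\alpha(b)=\max\{r\ge0:e_\alpha^{-r}(b)\neq\mathbf 0\}$. **Morphisms.** A morphism $B_1\to B_2$ is a map $\psi:B_1\cup\{\mathbf 0\}\to B_2\cup\{\mathbf 0\}$ with $\psi(\mathbf 0)=\mathbf 0$, preserving $wt,\varepsilon_\alpha,\varphi_\alpha$ on $B_1$, and with $e_\alpha^r(\psi(b))=\psi(e_\alpha^r(b))$ whenever $e_\alpha^r(b)\in B_1$. An isomorphism is a morphism having a two-sided inverse morphism. **Tensor product.** $B_1\otimes B_2$ is the set $B_1\times B_2$ with elements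 written $b_1\otimes b_2$. With $\sigma=\varphi_\alpha(b_1)-\varepsilon_\alpha(b_2)$ (where $(-\infty)-(-\infty)=0$), $\sigma^+=\max(0,\sigma)$, $\sigma^-=\max(0,-\sigma)$: $wt(b_1\otimes b_2)=wt(b_1)+wt(b_2)$, $\varepsilon_\alpha(b_1\otimes b_2)=\varepsilon_\alpha(b_1)+\sigma^-$, $\varphi_\alpha(b_1\otimes b_2)=\varphi_\alpha(b_2)+\sigma^+$, $e_\alpha^r(b_1\otimes b_2)=e_\alpha^{\max(r,-\sigma)-\sigma^-}b_1\otimes e_\alpha^{\min(r,-\sigma)+\sigma^+}b_2$, where $b_1\otimes\mathbf 0$ and $\mathbf 0\otimes b_2$ are understood to be $\mathbf 0$. **Highest weight.** Let $\mathcal F$ be the semigroup of all finite compositions $f_{\alpha_1}^{r_1}\cdots f_{\alpha_k}^{r_k}$, $\alpha_i\in\Sigma$, $r_i\ge0$, and for $b\in B$ let $\mathcal F(b)=\{f(b):f\in\mathcal F\}$, regarded as a subset of $B$ (that is, $\mathbf 0$ is discarded). A crystal $B(\lambda)$ is of highest weight $\lambda\in V$ if there is $b_\lambda\in B(\lambda)$ (then unique) with $wt(b_\lambda)=\lambda$, $e_\alpha^r(b_\lambda)=\mathbf 0$ for all $r>0,\alpha\in\Sigma$, and $B(\lambda)=\mathcal F(b_\lambda)$. **Closed family.** A family $(B(\lambda))_{\lambda\in\overline C}$ of highest weight continuous crystals is closed if for all $\lambda,\mu\in\overline C$ the subset $\mathcal F(b_\lambda\otimes b_\mu)$ of $B(\lambda)\otimes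 B(\mu)$ is a crystal isomorphic to $B(\lambda+\mu)$. *)

theory Defs
  imports
    "HOL-Algebra.Group_Action"
    "HOL-Algebra.Multiplicative_Group"
    "HOL-Library.Extended_Real"
begin

section \<open>Group presentations and Coxeter systems\<close>

text \<open>A word is a list of signed letters: \<open>(a, True)\<close> stands for the generator \<open>a\<close> and
  \<open>(a, False)\<close> for its formal inverse.\<close>

type_synonym 'a word = "('a \<times> bool) list"

definition words :: "'a set \<Rightarrow> 'a word set" where
  "words S = lists (S \<times> UNIV)"

definition word_eval :: "('a, 'm) monoid_scheme \<Rightarrow> 'a word \<Rightarrow> 'a" where
  "word_eval G w =
     foldr (\<lambda>(a, b) x. (if b then a else inv\<^bsub>G\<^esub> a) \<otimes>\<^bsub>G\<^esub> x) w \<one>\<^bsub>G\<^esub>"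

text \<open>The smallest congruence on words that cancels formal inverses and makes the relators in
  \<open>R\<close> trivial. Its quotient is the group with generators \<open>S\<close> and relators \<open>R\<close>.\<close>

inductive pres_eq :: "'a set \<Rightarrow> 'a word set \<Rightarrow> 'a word \<Rightarrow> 'a word \<Rightarrow> bool" for S R where
  refl: "w \<in> words S \<Longrightarrow> pres_eq S R w w"
| sym: "pres_eq S R u v \<Longrightarrow> pres_eq S R v u"
| trans: "pres_eq S R u v \<Longrightarrow> pres_eq S R v w \<Longrightarrow> pres_eq S R u w"
| append: "pres_eq S R u u' \<Longrightarrow> pres_eq S R v v' \<Longrightarrow> pres_eq S R (u @ v) (u' @ v')"
| cancel: "a \<in> S \<Longrightarrow> pres_eq S R [(a, b), (a, \<not> b)] []"
| relator: "r \<in> R \<Longrightarrow> r \<in> words S \<Longrightarrow> pres_eq S R r []"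

definition is_presentation :: "('a, 'm) monoid_scheme \<Rightarrow> 'a set \<Rightarrow> 'a word set \<Rightarrow> bool" where
  "is_presentation G S R \<longleftrightarrow>
     R \<subseteq> words S \<and> S \<subseteq> carrier G \<and> generate G S = carrier G \<and>
     (\<forall>u\<in>words S. \<forall>v\<in>words S. word_eval G u = word_eval G v \<longleftrightarrow> pres_eq S R u v)"

text \<open>In the library, \<open>group.ord\<close> is \<open>0\<close> on elements of infinite order.\<close>

definition coxeter_relators :: "('a, 'm) monoid_scheme \<Rightarrow> 'a set \<Rightarrow> 'a word set" where
  "coxeter_relators G S =
     {concat (replicate (group.ord G (s \<otimes>\<^bsub>G\<^esub> t)) [(s, True), (t, True)]) | s t.
        s \<in> S \<and> t \<in> S \<and> group.ord G (s \<otimes>\<^bsub>G\<^esub> t) \<noteq> 0}"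

locale coxeter_system = group W for W :: "('w, 'm) monoid_scheme" (structure) +
  fixes S :: "'w set"
  assumes finite_S: "finite S"
    and S_subset: "S \<subseteq> carrier W"
    and involution: "s \<in> S \<Longrightarrow> s \<noteq> \<one> \<and> s \<otimes> s = \<one>"
    and presentation: "is_presentation W S (coxeter_relators W S)"

section \<open>Realizations\<close>

locale realization = coxeter_system W S
  for W :: "('w, 'm) monoid_scheme" (structure) and S :: "'w set" +
  fixes act :: "'w \<Rightarrow> 'v::real_vector \<Rightarrow> 'v"
    and sroot :: "'w \<Rightarrow> 'v"
    and coroot :: "'w \<Rightarrow> 'v \<Rightarrow> real"
  assumes action: "group_action W UNIV act"
    and act_linear: "w \<in> carrier W \<Longrightarrow> linear (act w)"
    and coroot_linear: "s \<in> S \<Longrightarrow> linear (coroot s)"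
    and coroot_root: "s \<in> S \<Longrightarrow> coroot s (sroot s) = 2"
    and reflection: "s \<in> S \<Longrightarrow> act s x = x - coroot s x *\<^sub>R sroot s"

definition simple_roots :: "'w set \<Rightarrow> ('w \<Rightarrow> 'v) \<Rightarrow> 'v set" where
  "simple_roots S sroot = sroot ` S"

definition closed_chamber :: "'w set \<Rightarrow> ('w \<Rightarrow> 'v \<Rightarrow> real) \<Rightarrow> 'v set" where
  "closed_chamber S coroot = {v. \<forall>s\<in>S. coroot s v \<ge> 0}"

section \<open>Continuous crystals\<close>

text \<open>The maps are indexed by the simple roots, as vectors of \<open>'v\<close>. The ghost element is
  \<open>None\<close>. Only the restrictions of the maps to the carrier (and to the set of simple roots) are
  meaningful.\<close>

record ('b, 'v) crystal = "'b partial_object" +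
  wt :: "'b \<Rightarrow> 'v"
  eps :: "'v \<Rightarrow> 'b \<Rightarrow> ereal"
  phi :: "'v \<Rightarrow> 'b \<Rightarrow> ereal"
  eop :: "'v \<Rightarrow> real \<Rightarrow> 'b option \<Rightarrow> 'b option"

definition with_ghost :: "('b, 'v) crystal \<Rightarrow> 'b option set" where
  "with_ghost B = insert None (Some ` carrier B)"

text \<open>(C1) is imposed for every \<open>s\<close>, with \<open>\<alpha>\<^sub>s\<close> and \<open>\<alpha>\<^sub>s\<^sup>\<or>\<close>; thus the coroot of a simple root need
  not be chosen if several \<open>s\<close> share the same root.\<close>

definition continuous_crystal ::
  "'w set \<Rightarrow> ('w \<Rightarrow> 'v::real_vector) \<Rightarrow> ('w \<Rightarrow> 'v \<Rightarrow> real) \<Rightarrow> ('b, 'v) crystal \<Rightarrow> bool" where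
  "continuous_crystal S sroot coroot B \<longleftrightarrow>
     (\<forall>\<alpha>\<in>simple_roots S sroot. \<forall>b\<in>carrier B.
        eps B \<alpha> b \<noteq> \<infinity> \<and> phi B \<alpha> b \<noteq> \<infinity> \<and>
        (\<forall>r. eop B \<alpha> r (Some b) \<in> with_ghost B)) \<and>
     \<comment> \<open>(C1)\<close>
     (\<forall>s\<in>S. \<forall>b\<in>carrier B.
        phi B (sroot s) b = eps B (sroot s) b + ereal (coroot s (wt B b))) \<and>
     \<comment> \<open>(C2)\<close>
     (\<forall>\<alpha>\<in>simple_roots S sroot. \<forall>b\<in>carrier B. \<forall>r c.
        eop B \<alpha> r (Some b) = Some c \<longrightarrow>
          eps B \<alpha> c = eps B \<alpha> b - ereal r \<and>
          phi B \<alpha> c = phi B \<alpha> b + ereal r \<and>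
          wt B c = wt B b + r *\<^sub>R \<alpha>) \<and>
     \<comment> \<open>(C3)\<close>
     (\<forall>\<alpha>\<in>simple_roots S sroot. \<forall>r. eop B \<alpha> r None = None) \<and>
     (\<forall>\<alpha>\<in>simple_roots S sroot. \<forall>b\<in>carrier B. eop B \<alpha> 0 (Some b) = Some b) \<and>
     (\<forall>\<alpha>\<in>simple_roots S sroot. \<forall>b\<in>carrier B. \<forall>r. eop B \<alpha> r (Some b) \<noteq> None \<longrightarrow>
        (\<forall>s. eop B \<alpha> (s + r) (Some b) = eop B \<alpha> s (eop B \<alpha> r (Some b)))) \<and>
     \<comment> \<open>(C4)\<close>
     (\<forall>\<alpha>\<in>simple_roots S sroot. \<forall>b\<in>carrier B. phi B \<alpha> b = -\<infinity> \<longrightarrow>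
        (\<forall>r. r \<noteq> 0 \<longrightarrow> eop B \<alpha> r (Some b) = None))"

definition fop :: "('b, 'v) crystal \<Rightarrow> 'v \<Rightarrow> real \<Rightarrow> 'b option \<Rightarrow> 'b option" where
  "fop B \<alpha> r = eop B \<alpha> (- r)"

definition is_max :: "real set \<Rightarrow> ereal \<Rightarrow> bool" where
  "is_max A m \<longleftrightarrow> (\<exists>x\<in>A. m = ereal x \<and> (\<forall>y\<in>A. y \<le> x))"

definition normal_crystal :: "'v set \<Rightarrow> ('b, 'v) crystal \<Rightarrow> bool" where
  "normal_crystal \<Sigma> B \<longleftrightarrow>
     (\<forall>\<alpha>\<in>\<Sigma>. \<forall>b\<in>carrier B.
        is_max {r. r \<ge> 0 \<and> eop B \<alpha> r (Some b) \<noteq> None} (eps B \<alpha> b) \<and>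
        is_max {r. r \<ge> 0 \<and> eop B \<alpha> (- r) (Some b) \<noteq> None} (phi B \<alpha> b))"

text \<open>If \<open>\<psi>\<close> sends an element of the carrier to the ghost, there is no weight to preserve.\<close>

definition crystal_morphism ::
  "'v set \<Rightarrow> ('b, 'v) crystal \<Rightarrow> ('c, 'v) crystal \<Rightarrow> ('b option \<Rightarrow> 'c option) \<Rightarrow> bool" where
  "crystal_morphism \<Sigma> B1 B2 \<psi> \<longleftrightarrow>
     \<psi> ` with_ghost B1 \<subseteq> with_ghost B2 \<and>
     \<psi> None = None \<and>
     (\<forall>b\<in>carrier B1. \<forall>c. \<psi> (Some b) = Some c \<longrightarrow>
        wt B2 c = wt B1 b \<and>
        (\<forall>\<alpha>\<in>\<Sigma>. eps B2 \<alpha> c = eps B1 \<alpha> b \<and> phi B2 \<alpha> c = phi B1 \<alpha> b)) \<and>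
     (\<forall>\<alpha>\<in>\<Sigma>. \<forall>b\<in>carrier B1. \<forall>r. eop B1 \<alpha> r (Some b) \<noteq> None \<longrightarrow>
        eop B2 \<alpha> r (\<psi> (Some b)) = \<psi> (eop B1 \<alpha> r (Some b)))"

definition crystal_isomorphic ::
  "'v set \<Rightarrow> ('b, 'v) crystal \<Rightarrow> ('c, 'v) crystal \<Rightarrow> bool" where
  "crystal_isomorphic \<Sigma> B1 B2 \<longleftrightarrow>
     (\<exists>\<psi> \<chi>. crystal_morphism \<Sigma> B1 B2 \<psi> \<and> crystal_morphism \<Sigma> B2 B1 \<chi> \<and>
        (\<forall>x\<in>with_ghost B1. \<chi> (\<psi> x) = x) \<and> (\<forall>y\<in>with_ghost B2. \<psi> (\<chi> y) = y))"

section \<open>Tensor products\<close>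

text \<open>The case distinction is the convention \<open>(-\<infinity>) - (-\<infinity>) = 0\<close>, which differs from
  subtraction on \<open>ereal\<close>.\<close>

definition tensor_sigma ::
  "('b, 'v) crystal \<Rightarrow> ('c, 'v) crystal \<Rightarrow> 'v \<Rightarrow> 'b \<Rightarrow> 'c \<Rightarrow> ereal" where
  "tensor_sigma B1 B2 \<alpha> b1 b2 =
     (if phi B1 \<alpha> b1 = -\<infinity> \<and> eps B2 \<alpha> b2 = -\<infinity> then 0
      else phi B1 \<alpha> b1 - eps B2 \<alpha> b2)"

text \<open>For \<open>\<sigma> = \<plusminus>\<infinity>\<close>, \<open>real_of_ereal\<close> turns the exponents \<open>\<infinity> - \<infinity>\<close> below into \<open>0\<close>, the
  other exponent being \<open>r\<close>. The sums defining \<open>eps\<close> and \<open>phi\<close> are meant for operands that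
  are not opposite infinities; all values are finite when both factors are normal.\<close>

definition tensor :: "('b, 'v::real_vector) crystal \<Rightarrow> ('c, 'v) crystal \<Rightarrow> ('b \<times> 'c, 'v) crystal" where
  "tensor B1 B2 =
     \<lparr>carrier = carrier B1 \<times> carrier B2,
      wt = (\<lambda>(b1, b2). wt B1 b1 + wt B2 b2),
      eps = (\<lambda>\<alpha> (b1, b2). eps B1 \<alpha> b1 + max 0 (- tensor_sigma B1 B2 \<alpha> b1 b2)),
      phi = (\<lambda>\<alpha> (b1, b2). phi B2 \<alpha> b2 + max 0 (tensor_sigma B1 B2 \<alpha> b1 b2)),
      eop = (\<lambda>\<alpha> r x. case x of None \<Rightarrow> None
        | Some (b1, b2) \<Rightarrow>
            (let \<sigma> = tensor_sigma B1 B2 \<alpha> b1 b2;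
                 r1 = real_of_ereal (max (ereal r) (- \<sigma>) - max 0 (- \<sigma>));
                 r2 = real_of_ereal (min (ereal r) (- \<sigma>) + max 0 \<sigma>)
             in case (eop B1 \<alpha> r1 (Some b1), eop B2 \<alpha> r2 (Some b2)) of
                  (Some c1, Some c2) \<Rightarrow> Some (c1, c2)
                | _ \<Rightarrow> None))\<rparr>"

section \<open>Highest weight crystals and closed families\<close>

text \<open>\<open>\<F>(b)\<close>, with the ghost element discarded. The empty composition is allowed; this only matters
  when there are no simple roots, since \<open>f\<^sub>\<alpha>\<^sup>0\<close> is the identity.\<close>

definition f_orbit :: "'v set \<Rightarrow> ('b, 'v) crystal \<Rightarrow> 'b \<Rightarrow> 'b set" where
  "f_orbit \<Sigma> B b =
     {c. \<exists>ws. set ws \<subseteq> \<Sigma> \<times> {0..} \<and> foldr (\<lambda>(\<alpha>, r). fop B \<alpha> r) ws (Some b) = Some c}"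

definition highest_weight_element :: "'v set \<Rightarrow> ('b, 'v) crystal \<Rightarrow> 'v \<Rightarrow> 'b \<Rightarrow> bool" where
  "highest_weight_element \<Sigma> B lam b \<longleftrightarrow>
     b \<in> carrier B \<and> wt B b = lam \<and> (\<forall>\<alpha>\<in>\<Sigma>. \<forall>r>0. eop B \<alpha> r (Some b) = None) \<and>
     carrier B = f_orbit \<Sigma> B b"

definition highest_weight_crystal :: "'v set \<Rightarrow> ('b, 'v) crystal \<Rightarrow> 'v \<Rightarrow> bool" where
  "highest_weight_crystal \<Sigma> B lam \<longleftrightarrow> (\<exists>b. highest_weight_element \<Sigma> B lam b)"

text \<open>The crystal structure induced on a subset: an operator leading out of the subset gives the
  ghost.\<close>

definition subcrystal :: "('b, 'v) crystal \<Rightarrow> 'b set \<Rightarrow> ('b, 'v) crystal" where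
  "subcrystal B X =
     B\<lparr>carrier := X,
       eop := (\<lambda>\<alpha> r x. case eop B \<alpha> r x of None \<Rightarrow> None
                          | Some c \<Rightarrow> if c \<in> X then Some c else None)\<rparr>"

text \<open>In the last clause \<open>b\<close> and \<open>c\<close> are \<open>b\<^sub>\<lambda>\<close> and \<open>b\<^sub>\<mu>\<close>; highest weight elements are unique, so
  quantifying over them universally is the same as naming them.\<close>

definition closed_family ::
  "'w set \<Rightarrow> ('w \<Rightarrow> 'v::real_vector) \<Rightarrow> ('w \<Rightarrow> 'v \<Rightarrow> real) \<Rightarrow> ('v \<Rightarrow> ('b, 'v) crystal) \<Rightarrow> bool"
where
  "closed_family S sroot coroot B \<longleftrightarrow>
     (let \<Sigma> = simple_roots S sroot; C = closed_chamber S coroot in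
      (\<forall>lam\<in>C. continuous_crystal S sroot coroot (B lam) \<and> highest_weight_crystal \<Sigma> (B lam) lam) \<and>
      (\<forall>lam\<in>C. \<forall>mu\<in>C. \<forall>b c.
         highest_weight_element \<Sigma> (B lam) lam b \<longrightarrow> highest_weight_element \<Sigma> (B mu) mu c \<longrightarrow>
         (let T = tensor (B lam) (B mu); F = subcrystal T (f_orbit \<Sigma> T (b, c)) in
          continuous_crystal S sroot coroot F \<and> crystal_isomorphic \<Sigma> F (B (lam + mu)))))"

end

theory Submission
  imports Defs
begin

text \<open>Fix \<open>lam\<close> in the closed chamber. Only the crystals \<open>B (t lam)\<close>, \<open>t \<ge> 0\<close>, are needed. Closedness
  splits every \<open>p \<in> B ((s + u) lam)\<close> as \<open>pre \<otimes> suf \<in> B (s lam) \<otimes> B (u lam)\<close>, coassociatively, so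
  \<open>p\<close> has a path \<open>s \<mapsto> wt (pre p s)\<close>. The point is that \<open>\<epsilon>\<^sub>\<alpha> p\<close> is minus the minimum of \<open>\<alpha>\<^sup>\<or>\<close>
  along this path; then the operators act on paths by a fixed rule, equality of paths is a
  bisimulation between two families, and since an element with all \<open>\<epsilon>\<^sub>\<alpha> = 0\<close> is the highest weight
  element, this bisimulation is an isomorphism.

  The formula for \<open>\<epsilon>\<^sub>\<alpha>\<close> can only fail if some \<open>\<epsilon>\<^sub>\<alpha>\<close> stays large on arbitrarily short factors of \<open>p\<close>.
  By induction over words in the \<open>f\<^sub>\<alpha>\<close>, every element starts with a factor all of whose subfactors
  of equal length agree; so its path starts linearly. Applied to \<open>e\<^sub>\<alpha>\<^sup>m\<^sup>a\<^sup>x p\<close>, whose initial factor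
  is \<open>e\<^sub>\<alpha>\<^sup>m\<^sup>a\<^sup>x\<close> of that of \<open>p\<close>, this shows that \<open>\<epsilon>\<^sub>\<alpha>\<close> of short initial factors tends to \<open>0\<close>. With
  this, the same induction works for final factors, and compactness gives the claim.\<close>

section \<open>Crystals along a ray\<close>

text \<open>The exponent of \<open>e\<^sub>\<alpha>\<^sup>r\<close> on the first factor of a tensor product; the second one gets
  \<open>r - share r \<sigma> = min r (- \<sigma>) + max 0 \<sigma>\<close>.\<close>

definition share :: "real \<Rightarrow> real \<Rightarrow> real" where
  "share r \<sigma> = max r (- \<sigma>) - max 0 (- \<sigma>)"

text \<open>Lowering by \<open>- r\<close> first uses up \<open>max 0 \<sigma>\<close> on the first
  factor; only the remainder reaches the second.\<close>

lemma share_nonpos: "r \<le> 0 \<Longrightarrow> share r \<sigma> = - min (- r) (max 0 \<sigma>)"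
  by (auto simp: share_def max_def min_def)

text \<open>Associativity of the tensor product at the level of exponents. For factors x, y, z,
  \<open>pc\<close> is phi of x, \<open>em\<close> and \<open>pm\<close> are epsilon and phi of y,
  and \<open>ez\<close> is epsilon of z; \<open>\<sigma>1\<close> belongs to the bracketing (x y) z
  and \<open>\<sigma>2\<close> to x (y z). The equations compare what reaches x, y and z.\<close>

lemma share_assoc:
  fixes r pc em pm ez :: real
  defines "\<sigma>1 \<equiv> pm + max 0 (pc - em) - ez" and "\<sigma>2 \<equiv> pc - (em + max 0 (ez - pm))"
  shows "share (share r \<sigma>1) (pc - em) = share r \<sigma>2"
    and "share r \<sigma>1 - share (share r \<sigma>1) (pc - em) = share (r - share r \<sigma>2) (pm - ez)"
    and "r - share r \<sigma>1 = (r - share r \<sigma>2) - share (r - share r \<sigma>2) (pm - ez)"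
  unfolding share_def \<sigma>1_def \<sigma>2_def max_def by (simp_all split: if_split; linarith)+

text \<open>\<open>P\<close> is the disjoint union of the \<open>B (t lam)\<close>, with \<open>t = len p\<close>; \<open>ep\<close> and \<open>e\<close> are \<open>\<epsilon>\<close> and the
  crystal operators (\<open>None\<close> is the ghost), \<open>cp\<close> is the pairing with coroots, and \<open>pre p s\<close>, \<open>suf p s\<close>
  are the factors of \<open>p\<close> in \<open>B (s lam)\<close> and \<open>B ((len p - s) lam)\<close>. Normality only describes the ends
  of a string, so \<open>e \<alpha> r p \<noteq> None\<close> is not assumed for intermediate \<open>r\<close>. The converse of
  \<open>e_split\<close> is restricted to lowering operators, under which an \<open>\<F>\<close>-orbit is stable.\<close>

locale crystal_ray =
  fixes \<Sigma> :: "'v::real_vector set" and cp :: "'v \<Rightarrow> 'v \<Rightarrow> real" and lam :: 'v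
    and P :: "'p set" and len :: "'p \<Rightarrow> real" and w :: "'p \<Rightarrow> 'v" and ep :: "'v \<Rightarrow> 'p \<Rightarrow> real"
    and e :: "'v \<Rightarrow> real \<Rightarrow> 'p \<Rightarrow> 'p option" and top :: "real \<Rightarrow> 'p"
    and pre suf :: "'p \<Rightarrow> real \<Rightarrow> 'p"
  assumes cp_linear: "\<alpha> \<in> \<Sigma> \<Longrightarrow> linear (cp \<alpha>)"
    and cp_self: "\<alpha> \<in> \<Sigma> \<Longrightarrow> cp \<alpha> \<alpha> = 2"
    and len_nonneg: "p \<in> P \<Longrightarrow> 0 \<le> len p"
    and ep_nonneg: "\<alpha> \<in> \<Sigma> \<Longrightarrow> p \<in> P \<Longrightarrow> 0 \<le> ep \<alpha> p"
    and ep_w_nonneg: "\<alpha> \<in> \<Sigma> \<Longrightarrow> p \<in> P \<Longrightarrow> 0 \<le> ep \<alpha> p + cp \<alpha> (w p)"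
    and e_Some: "\<alpha> \<in> \<Sigma> \<Longrightarrow> p \<in> P \<Longrightarrow> e \<alpha> r p = Some p' \<Longrightarrow>
      p' \<in> P \<and> len p' = len p \<and> ep \<alpha> p' = ep \<alpha> p - r \<and> w p' = w p + r *\<^sub>R \<alpha>"
    and e_zero: "\<alpha> \<in> \<Sigma> \<Longrightarrow> p \<in> P \<Longrightarrow> e \<alpha> 0 p = Some p"
    and e_add: "\<alpha> \<in> \<Sigma> \<Longrightarrow> p \<in> P \<Longrightarrow> e \<alpha> r p = Some p' \<Longrightarrow> e \<alpha> (s + r) p = e \<alpha> s p'"
    and e_ep: "\<alpha> \<in> \<Sigma> \<Longrightarrow> p \<in> P \<Longrightarrow> e \<alpha> (ep \<alpha> p) p \<noteq> None"
    and e_ph: "\<alpha> \<in> \<Sigma> \<Longrightarrow> p \<in> P \<Longrightarrow> e \<alpha> (- (ep \<alpha> p + cp \<alpha> (w p))) p \<noteq> None"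
    and top: "0 \<le> t \<Longrightarrow> top t \<in> P \<and> len (top t) = t \<and> w (top t) = t *\<^sub>R lam"
    and ep_top: "\<alpha> \<in> \<Sigma> \<Longrightarrow> 0 \<le> t \<Longrightarrow> ep \<alpha> (top t) = 0"
    and generated: "p \<in> P \<Longrightarrow> (\<And>t. 0 \<le> t \<Longrightarrow> Q (top t)) \<Longrightarrow>
      (\<And>q \<alpha> r q'. q \<in> P \<Longrightarrow> Q q \<Longrightarrow> \<alpha> \<in> \<Sigma> \<Longrightarrow> 0 \<le> r \<Longrightarrow> e \<alpha> (- r) q = Some q' \<Longrightarrow> Q q') \<Longrightarrow> Q p"
    and split: "p \<in> P \<Longrightarrow> 0 \<le> s \<Longrightarrow> s \<le> len p \<Longrightarrow>
      pre p s \<in> P \<and> suf p s \<in> P \<and> len (pre p s) = s \<and> len (suf p s) = len p - s \<and>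
      w p = w (pre p s) + w (suf p s)"
    and ep_split: "\<alpha> \<in> \<Sigma> \<Longrightarrow> p \<in> P \<Longrightarrow> 0 \<le> s \<Longrightarrow> s \<le> len p \<Longrightarrow>
      ep \<alpha> p = max (ep \<alpha> (pre p s)) (ep \<alpha> (suf p s) - cp \<alpha> (w (pre p s)))"
    and e_split: "\<alpha> \<in> \<Sigma> \<Longrightarrow> p \<in> P \<Longrightarrow> 0 \<le> s \<Longrightarrow> s \<le> len p \<Longrightarrow> e \<alpha> r p = Some p' \<Longrightarrow>
      c = share r (ep \<alpha> (pre p s) + cp \<alpha> (w (pre p s)) - ep \<alpha> (suf p s)) \<Longrightarrow>
      e \<alpha> c (pre p s) = Some (pre p' s) \<and> e \<alpha> (r - c) (suf p s) = Some (suf p' s)"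
    and f_split: "\<alpha> \<in> \<Sigma> \<Longrightarrow> p \<in> P \<Longrightarrow> 0 \<le> s \<Longrightarrow> s \<le> len p \<Longrightarrow> 0 \<le> r \<Longrightarrow>
      c = share (- r) (ep \<alpha> (pre p s) + cp \<alpha> (w (pre p s)) - ep \<alpha> (suf p s)) \<Longrightarrow>
      e \<alpha> c (pre p s) \<noteq> None \<Longrightarrow> e \<alpha> (- r - c) (suf p s) \<noteq> None \<Longrightarrow> e \<alpha> (- r) p \<noteq> None"
    and split_top: "0 \<le> s \<Longrightarrow> s \<le> t \<Longrightarrow> pre (top t) s = top s \<and> suf (top t) s = top (t - s)"
begin

section \<open>Epsilon, phi and the top elements\<close>

definition ph :: "'v \<Rightarrow> 'p \<Rightarrow> real" where
  "ph \<alpha> p = ep \<alpha> p + cp \<alpha> (w p)"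

lemma cp_simps:
  assumes "\<alpha> \<in> \<Sigma>"
  shows "cp \<alpha> (x + y) = cp \<alpha> x + cp \<alpha> y" "cp \<alpha> (x - y) = cp \<alpha> x - cp \<alpha> y"
    "cp \<alpha> (r *\<^sub>R x) = r * cp \<alpha> x" "cp \<alpha> 0 = 0"
  using linear_add[OF cp_linear[OF assms]] linear_diff[OF cp_linear[OF assms]]
    linear_scale[OF cp_linear[OF assms]] linear_0[OF cp_linear[OF assms]] by auto

lemma ph_nonneg: "\<alpha> \<in> \<Sigma> \<Longrightarrow> p \<in> P \<Longrightarrow> 0 \<le> ph \<alpha> p"
  using ep_w_nonneg by (simp add: ph_def)

lemma ph_e: "\<alpha> \<in> \<Sigma> \<Longrightarrow> p \<in> P \<Longrightarrow> e \<alpha> r p = Some p' \<Longrightarrow> ph \<alpha> p' = ph \<alpha> p + r"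
  using e_Some[of \<alpha> p r p'] cp_self[of \<alpha>] by (simp add: ph_def cp_simps)

lemma e_range:
  assumes "\<alpha> \<in> \<Sigma>" "p \<in> P" "e \<alpha> r p = Some p'"
  shows "- ph \<alpha> p \<le> r" "r \<le> ep \<alpha> p"
  using e_Some[OF assms] ph_e[OF assms] ep_nonneg[OF assms(1)] ph_nonneg[OF assms(1)] by fastforce+

lemma ep_split': "\<alpha> \<in> \<Sigma> \<Longrightarrow> p \<in> P \<Longrightarrow> 0 \<le> s \<Longrightarrow> s \<le> len p \<Longrightarrow>
    ep \<alpha> p = ep \<alpha> (pre p s) + max 0 (ep \<alpha> (suf p s) - ph \<alpha> (pre p s))"
  using ep_split[of \<alpha> p s] by (simp add: ph_def max_def)

lemma ph_split:
  assumes "\<alpha> \<in> \<Sigma>" "p \<in> P" "0 \<le> s" "s \<le> len p"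
  shows "ph \<alpha> p = ph \<alpha> (suf p s) + max 0 (ph \<alpha> (pre p s) - ep \<alpha> (suf p s))"
proof -
  have "cp \<alpha> (w p) = cp \<alpha> (w (pre p s)) + cp \<alpha> (w (suf p s))"
    using split[OF assms(2-4)] cp_simps[OF assms(1)] by metis
  then show ?thesis
    using ep_split'[OF assms] unfolding ph_def by (auto simp: max_def)
qed

text \<open>A lowering step with \<open>r > 0\<close> ends with epsilon at least \<open>r\<close>.
  So along generation an element is a \<open>top\<close> or has some positive epsilon.\<close>

lemma top_unique:
  assumes "p \<in> P" "\<And>\<alpha>. \<alpha> \<in> \<Sigma> \<Longrightarrow> ep \<alpha> p = 0"
  shows "p = top (len p)"
proof -
  have "p = top (len p) \<or> (\<exists>\<alpha>\<in>\<Sigma>. ep \<alpha> p > 0)"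
  proof (rule generated[OF assms(1)])
    fix t :: real assume "0 \<le> t"
    then show "top t = top (len (top t)) \<or> (\<exists>\<alpha>\<in>\<Sigma>. ep \<alpha> (top t) > 0)"
      using top by simp
  next
    fix q \<alpha> r q'
    assume q: "q \<in> P" "q = top (len q) \<or> (\<exists>\<alpha>\<in>\<Sigma>. ep \<alpha> q > 0)" "\<alpha> \<in> \<Sigma>" "(0::real) \<le> r"
      "e \<alpha> (- r) q = Some q'"
    show "q' = top (len q') \<or> (\<exists>\<alpha>\<in>\<Sigma>. ep \<alpha> q' > 0)"
    proof (cases "r = 0")
      case True
      then show ?thesis using q e_zero by simp
    next
      case False
      then have "ep \<alpha> q' > 0"
        using e_Some[OF q(3,1,5)] ep_nonneg[OF q(3,1)] q(4) by linarith
      then show ?thesis using q(3) by blast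
    qed
  qed
  then show ?thesis using assms(2) by force
qed

text \<open>The top element of length 0 has weight 0 and epsilon 0, hence phi 0, so no nontrivial
  lowering starts from it.\<close>

lemma len_0:
  assumes "p \<in> P" "len p = 0"
  shows "p = top 0"
proof -
  have "len p = 0 \<longrightarrow> p = top 0"
  proof (rule generated[OF assms(1)])
    fix t :: real assume "0 \<le> t"
    then show "len (top t) = 0 \<longrightarrow> top t = top 0" using top by simp
  next
    fix q \<alpha> r q'
    assume q: "q \<in> P" "len q = 0 \<longrightarrow> q = top 0" "\<alpha> \<in> \<Sigma>" "(0::real) \<le> r" "e \<alpha> (- r) q = Some q'"
    show "len q' = 0 \<longrightarrow> q' = top 0"
    proof
      assume "len q' = 0"
      then have "q = top 0" using q e_Some[OF q(3,1,5)] by simp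
      then have "ph \<alpha> q = 0" using q(3) top[of 0] ep_top[of \<alpha> 0] by (simp add: ph_def cp_simps)
      then have "r = 0" using e_range[OF q(3,1,5)] q(4) by simp
      then show "q' = top 0" using q \<open>q = top 0\<close> e_zero by simp
    qed
  qed
  then show ?thesis using assms by simp
qed

section \<open>Coassociativity and the endpoints of a splitting\<close>

lemma top_0: "\<alpha> \<in> \<Sigma> \<Longrightarrow> ep \<alpha> (top 0) = 0" "\<alpha> \<in> \<Sigma> \<Longrightarrow> ph \<alpha> (top 0) = 0" "w (top 0) = 0"
  using ep_top[of \<alpha> 0] top[of 0] by (auto simp: ph_def cp_simps)

lemma pre_0: "p \<in> P \<Longrightarrow> pre p 0 = top 0"
  using split[of p 0] len_nonneg len_0 by auto

lemma suf_len: "p \<in> P \<Longrightarrow> suf p (len p) = top 0"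
  using split[of p "len p"] len_nonneg len_0 by auto

text \<open>Tops split into tops, and a lowering operator distributes its exponent over three
  factors independently of the bracketing, by \<open>share_assoc\<close>. So the identities pass
  along generation.\<close>

lemma coassoc:
  assumes "p \<in> P" "0 \<le> s" "s \<le> t" "t \<le> len p"
  shows "pre (pre p t) s = pre p s \<and> suf (pre p t) s = pre (suf p s) (t - s) \<and>
    suf (suf p s) (t - s) = suf p t"
proof -
  have "t \<le> len p \<longrightarrow> pre (pre p t) s = pre p s \<and> suf (pre p t) s = pre (suf p s) (t - s) \<and>
    suf (suf p s) (t - s) = suf p t"
  proof (rule generated[OF assms(1)])
    fix u :: real assume "0 \<le> u"
    then show "t \<le> len (top u) \<longrightarrow> pre (pre (top u) t) s = pre (top u) s \<and>
      suf (pre (top u) t) s = pre (suf (top u) s) (t - s) \<and> suf (suf (top u) s) (t - s) = suf (top u) t"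
      using assms(2,3) top split_top by simp
  next
    fix q \<alpha> r q'
    assume q: "q \<in> P" "t \<le> len q \<longrightarrow> pre (pre q t) s = pre q s \<and>
      suf (pre q t) s = pre (suf q s) (t - s) \<and> suf (suf q s) (t - s) = suf q t"
      "\<alpha> \<in> \<Sigma>" "(0::real) \<le> r" and e: "e \<alpha> (- r) q = Some q'"
    show "t \<le> len q' \<longrightarrow> pre (pre q' t) s = pre q' s \<and>
      suf (pre q' t) s = pre (suf q' s) (t - s) \<and> suf (suf q' s) (t - s) = suf q' t"
    proof
      assume "t \<le> len q'"
      then have t: "t \<le> len q" using e_Some[OF q(3,1) e] by simp
      with q(2) have IH: "pre (pre q t) s = pre q s" "suf (pre q t) s = pre (suf q s) (t - s)"
        "suf (suf q s) (t - s) = suf q t" by auto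
      have st: "pre q t \<in> P" "s \<le> len (pre q t)" "0 \<le> t" "s \<le> len q" "suf q s \<in> P"
        "0 \<le> t - s" "t - s \<le> len (suf q s)"
        using split[OF q(1), of t] split[OF q(1), of s] assms(2,3) t by auto
      \<comment> \<open>Data of the factors on [0, s], [s, t] and [t, len q]. By the induction
        hypothesis both bracketings yield the same three factors, so \<open>\<sigma>1\<close> and
        \<open>\<sigma>2\<close> are computed from the same numbers.\<close>
      define pc em pm ez where "pc = ph \<alpha> (pre q s)" and "em = ep \<alpha> (suf (pre q t) s)"
        and "pm = ph \<alpha> (suf (pre q t) s)" and "ez = ep \<alpha> (suf q t)"
      define \<sigma>1 \<sigma>2 where "\<sigma>1 = pm + max 0 (pc - em) - ez" and "\<sigma>2 = pc - (em + max 0 (ez - pm))"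
      have \<sigma>1: "ep \<alpha> (pre q t) + cp \<alpha> (w (pre q t)) - ep \<alpha> (suf q t) = \<sigma>1"
        using ph_split[OF q(3) st(1) assms(2) st(2)] IH
        by (simp add: \<sigma>1_def pc_def em_def pm_def ez_def ph_def)
      have \<sigma>2: "ep \<alpha> (pre q s) + cp \<alpha> (w (pre q s)) - ep \<alpha> (suf q s) = \<sigma>2"
        using ep_split'[OF q(3) st(5-7)] IH
        by (simp add: \<sigma>2_def pc_def em_def pm_def ez_def ph_def)
      note a = e_split[OF q(3,1) st(3) t e \<sigma>1[symmetric, THEN arg_cong[where f = "share (- r)"]]]
      note b = e_split[OF q(3,1) assms(2) st(4) e \<sigma>2[symmetric, THEN arg_cong[where f = "share (- r)"]]]
      note a' = e_split[OF q(3) st(1) assms(2) st(2) a[THEN conjunct1] HOL.refl]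
      note b' = e_split[OF q(3) st(5-7) b[THEN conjunct2] HOL.refl]
      have x: "ep \<alpha> (pre (pre q t) s) + cp \<alpha> (w (pre (pre q t) s)) - ep \<alpha> (suf (pre q t) s) = pc - em"
        by (simp add: pc_def em_def ph_def IH)
      have y: "ep \<alpha> (pre (suf q s) (t - s)) + cp \<alpha> (w (pre (suf q s) (t - s)))
          - ep \<alpha> (suf (suf q s) (t - s)) = pm - ez"
        by (simp add: pm_def ez_def ph_def IH)
      show "pre (pre q' t) s = pre q' s \<and> suf (pre q' t) s = pre (suf q' s) (t - s) \<and>
        suf (suf q' s) (t - s) = suf q' t"
        using a b a'[unfolded x] b'[unfolded y] share_assoc[of "-r" pm pc em ez] IH
        unfolding \<sigma>1_def[symmetric] \<sigma>2_def[symmetric] by (metis option.inject)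
    qed
  qed
  then show ?thesis using assms(4) by simp
qed

text \<open>Splitting at an endpoint comes from an arbitrary isomorphism. It is trivial because the
  factor \<open>top 0\<close> has epsilon and phi 0, so lowering acts on the other factor
  alone.\<close>

lemma pre_len_suf_0:
  assumes "p \<in> P"
  shows "pre p (len p) = p \<and> suf p 0 = p"
proof (rule generated[OF assms])
  fix t :: real assume "0 \<le> t"
  then show "pre (top t) (len (top t)) = top t \<and> suf (top t) 0 = top t"
    using top split_top by simp
next
  fix q \<alpha> r q'
  assume q: "q \<in> P" "pre q (len q) = q \<and> suf q 0 = q" "\<alpha> \<in> \<Sigma>" "(0::real) \<le> r"
    and e: "e \<alpha> (- r) q = Some q'"
  have l: "0 \<le> len q" "len q' = len q"
    using len_nonneg q(1) e_Some[OF q(3,1) e] by auto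
  have r: "r \<le> ph \<alpha> q" using e_range[OF q(3,1) e] by simp
  have "e \<alpha> (- r) q = Some (pre q' (len q))"
    using e_split[OF q(3,1) l(1) order_refl e HOL.refl] q r suf_len[OF q(1)] top_0(1,2)[OF q(3)] ph_nonneg[OF q(3,1)]
    by (simp add: share_nonpos ph_def)
  moreover have "e \<alpha> (- r) q = Some (suf q' 0)"
    using e_split[OF q(3,1) order_refl l(1) e HOL.refl] q pre_0[OF q(1)] top_0(2)[OF q(3)] ep_nonneg[OF q(3,1)]
    by (simp add: share_nonpos ph_def)
  ultimately show "pre q' (len q') = q' \<and> suf q' 0 = q'"
    using e l by simp
qed

lemmas pre_len = pre_len_suf_0[THEN conjunct1] and suf_0 = pre_len_suf_0[THEN conjunct2]

text \<open>Here sigma is at most 0, so the first factor gets exponent 0.\<close>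

lemma pre_f_unaffected:
  assumes "\<alpha> \<in> \<Sigma>" "p \<in> P" "0 \<le> s" "s \<le> len p" "0 \<le> r" "e \<alpha> (- r) p = Some p'"
    and "ph \<alpha> (pre p s) \<le> ep \<alpha> (suf p s)"
  shows "pre p' s = pre p s"
  using e_split[OF assms(1-4,6) HOL.refl] assms(5,7) e_zero[OF assms(1)] split[OF assms(2-4)]
  by (simp add: share_nonpos ph_def)

subsection \<open>Homogeneous elements\<close>

text \<open>The analogue of a straight path with velocity \<open>\<nu>\<close>. The element
  \<open>suf (pre q (s + u)) s\<close> is the factor of \<open>q\<close> on [s, s + u]; the last
  clause is an equality of crystal elements, not just of their weights.\<close>

definition homog :: "'p \<Rightarrow> 'v \<Rightarrow> bool" where
  "homog q \<nu> \<longleftrightarrow> q \<in> P \<and> 0 < len q \<and>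
     (\<forall>u. 0 \<le> u \<and> u \<le> len q \<longrightarrow> w (pre q u) = u *\<^sub>R \<nu>) \<and>
     (\<forall>s u. 0 < s \<and> 0 < u \<and> s + u \<le> len q \<longrightarrow> suf (pre q (s + u)) s = pre q u)"

lemma homogD:
  assumes "homog q \<nu>"
  shows "q \<in> P" "0 < len q" "0 \<le> u \<Longrightarrow> u \<le> len q \<Longrightarrow> w (pre q u) = u *\<^sub>R \<nu>"
    "0 < s \<Longrightarrow> 0 < u \<Longrightarrow> s + u \<le> len q \<Longrightarrow> suf (pre q (s + u)) s = pre q u"
    "0 \<le> u \<Longrightarrow> u \<le> len q \<Longrightarrow> pre q u \<in> P"
    "0 \<le> u \<Longrightarrow> u \<le> len q \<Longrightarrow> len (pre q u) = u"
  using assms split[of q u] by (auto simp: homog_def)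

lemma homog_pre:
  assumes "homog q \<nu>" "0 < s" "s \<le> len q"
  shows "homog (pre q s) \<nu>"
proof -
  have "pre (pre q s) u = pre q u" if "0 \<le> u" "u \<le> s" for u
    using coassoc[of q u s] that assms homogD[OF assms(1)] by simp
  then show ?thesis
    using assms homogD[OF assms(1)] homogD(5,6)[OF assms(1), of s] unfolding homog_def by auto
qed

lemma homog_suf:
  assumes "homog q \<nu>" "0 \<le> s" "s < len q"
  shows "suf q s = pre q (len q - s)"
proof (cases "s = 0")
  case True
  then show ?thesis using pre_len suf_0 homogD(1)[OF assms(1)] by simp
next
  case False
  then show ?thesis
    using homogD(4)[OF assms(1), of s "len q - s"] assms pre_len homogD(1)[OF assms(1)] by simp
qed

lemma homog_top: "0 < t \<Longrightarrow> homog (top t) lam"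
  using top split_top by (auto simp: homog_def)

section \<open>Epsilon, phi and reflections of homogeneous elements\<close>

lemma homog_ph:
  assumes "homog q \<nu>" "\<alpha> \<in> \<Sigma>" "0 \<le> u" "u \<le> len q"
  shows "ph \<alpha> (pre q u) = ep \<alpha> (pre q u) + u * cp \<alpha> \<nu>"
  using homogD(3)[OF assms(1,3,4)] assms(2) by (simp add: ph_def cp_simps)

text \<open>The tensor formula, with homogeneity replacing the second factor by
  \<open>pre q u\<close>. Since the left side is symmetric in \<open>s\<close> and \<open>u\<close>,
  this is a rigid functional equation.\<close>

lemma homog_ep_add:
  assumes "homog q \<nu>" "\<alpha> \<in> \<Sigma>" "0 < s" "0 < u" "s + u \<le> len q"
  shows "ep \<alpha> (pre q (s + u)) = max (ep \<alpha> (pre q s)) (ep \<alpha> (pre q u) - s * cp \<alpha> \<nu>)"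
proof -
  have "pre (pre q (s + u)) s = pre q s"
    using coassoc[of q s "s + u"] homogD(1)[OF assms(1)] assms by simp
  then show ?thesis
    using ep_split[OF assms(2) homogD(5)[OF assms(1)], of "s + u" s] homogD(6)[OF assms(1), of "s + u"]
      homogD(3)[OF assms(1), of s] homogD(4)[OF assms(1,3-5)] assms
    by (simp add: cp_simps)
qed

text \<open>Let g(s) be epsilon of \<open>pre q s\<close> and k the pairing. Then g(s+u) is both
  max(g(s), g(u) - s k) and max(g(u), g(s) - u k). If k > 0, the value g(u) - s k is below g(u),
  hence below g(s+u), so g(s+u) = g(s).\<close>

lemma homog_ep_const:
  assumes "homog q \<nu>" "\<alpha> \<in> \<Sigma>" "0 \<le> cp \<alpha> \<nu>" "0 < s" "s \<le> len q"
  shows "ep \<alpha> (pre q s) = ep \<alpha> q"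
proof -
  let ?\<kappa> = "cp \<alpha> \<nu>"
  define l where "l = len q"
  have l: "0 < l" "pre q l = q" using homogD[OF assms(1)] pre_len by (auto simp: l_def)
  have add: "ep \<alpha> (pre q (s + u)) = max (ep \<alpha> (pre q s)) (ep \<alpha> (pre q u) - s * ?\<kappa>)"
    if "0 < s" "0 < u" "s + u \<le> l" for s u
    using homog_ep_add[OF assms(1,2)] that by (simp add: l_def)
  have mono: "ep \<alpha> (pre q s) \<le> ep \<alpha> q"
    using add[of s "l - s"] l assms(4,5) by (cases "s = l") (auto simp: l_def)
  show ?thesis
  proof (cases "s = l")
    case False
    define u where "u = l - s"
    have u: "0 < u" "s + u = l" "u + s = l" using False assms(5) by (auto simp: u_def l_def)
    show ?thesis
    proof (cases "?\<kappa> = 0")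
      case True
      \<comment> \<open>With pairing 0 the equation is g(s+u) = max(g(s), g(u)). Taking s = u shows
        that halving preserves g; by monotonicity every \<open>s\<close> is squeezed between some
        \<open>l / 2 ^ n\<close> and \<open>l\<close>.\<close>
      have half: "ep \<alpha> (pre q (l / 2 ^ n)) = ep \<alpha> q" for n
      proof (induction n)
        case (Suc n)
        have "(l::real) / 2 ^ Suc n + l / 2 ^ Suc n = l / 2 ^ n" by (simp add: field_simps)
        moreover have "l / 2 ^ n \<le> l" using l by (simp add: divide_le_eq)
        ultimately show ?case
          using add[of "l / 2 ^ Suc n" "l / 2 ^ Suc n"] l True Suc by simp
      qed (simp add: l)
      obtain n where "l / s < 2 ^ n" using real_arch_pow[of 2 "l / s"] by auto
      then have n: "l / 2 ^ n < s" using assms(4) by (simp add: field_simps)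
      then have "ep \<alpha> (pre q (l / 2 ^ n)) \<le> ep \<alpha> (pre q s)"
        using add[of "l / 2 ^ n" "s - l / 2 ^ n"] l assms(4,5) by (simp add: l_def)
      then show ?thesis using mono half by simp
    next
      case False
      have "0 < s * ?\<kappa>" "0 < u * ?\<kappa>" using False assms(3,4) u by auto
      then show ?thesis
        using add[of s u] add[of u s] l u assms(4) by (auto simp: max_def split: if_splits)
    qed
  qed (simp add: l)
qed

text \<open>For negative pairing, exchanging \<open>s\<close> and \<open>u\<close> constrains phi as
  it constrains epsilon in \<open>homog_ep_const\<close>; for pairing 0 the two functions
  coincide.\<close>

lemma homog_ph_const:
  assumes "homog q \<nu>" "\<alpha> \<in> \<Sigma>" "cp \<alpha> \<nu> \<le> 0" "0 < s" "s \<le> len q"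
  shows "ph \<alpha> (pre q s) = ph \<alpha> q"
proof -
  define l \<kappa> where "l = len q" and "\<kappa> = - cp \<alpha> \<nu>"
  have l: "0 < l" "pre q l = q" using homogD[OF assms(1)] pre_len by (auto simp: l_def)
  have ph: "ph \<alpha> (pre q s) = ep \<alpha> (pre q s) - s * \<kappa>" if "0 \<le> s" "s \<le> l" for s
    using homog_ph[OF assms(1,2) that(1)] that(2) by (simp add: l_def \<kappa>_def)
  have "\<kappa> = 0 \<or> s = l \<or> \<kappa> > 0 \<and> s < l" using assms(3,5) by (auto simp: \<kappa>_def l_def)
  then show ?thesis
  proof (elim disjE)
    assume "\<kappa> = 0"
    then show ?thesis
      using homog_ep_const[OF assms(1,2) _ assms(4,5)] ph[of s] ph[of l] l assms(4,5)
      by (simp add: \<kappa>_def l_def)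
  next
    assume *: "\<kappa> > 0 \<and> s < l"
    define u where "u = l - s"
    have u: "0 < u" "s + u = l" "u + s = l" "s \<le> l" "u \<le> l" "l * \<kappa> = s * \<kappa> + u * \<kappa>"
      using * assms(4,5) by (auto simp: u_def l_def algebra_simps)
    have "ep \<alpha> q = max (ep \<alpha> (pre q s)) (ep \<alpha> (pre q u) + s * \<kappa>)"
      "ep \<alpha> q = max (ep \<alpha> (pre q u)) (ep \<alpha> (pre q s) + u * \<kappa>)"
      using homog_ep_add[OF assms(1,2), of s u] homog_ep_add[OF assms(1,2), of u s] assms(4) u l
      by (auto simp: \<kappa>_def l_def)
    moreover have "0 < s * \<kappa>" "0 < u * \<kappa>" using * assms(4) u by auto
    ultimately show ?thesis
      using ph[of s] ph[of u] ph[of l] l u assms(4) by (auto simp: max_def split: if_splits)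
  qed (simp add: l)
qed

text \<open>The exponent is shared in proportion to length: each factor of length \<open>u\<close>
  is lowered by \<open>u * cp \<alpha> \<nu>\<close>. Equal factors thus stay equal, and the
  velocity is reflected.\<close>

lemma homog_reflect:
  assumes q: "homog q \<nu>" and \<alpha>: "\<alpha> \<in> \<Sigma>" and \<kappa>: "0 < cp \<alpha> \<nu>"
    and e: "e \<alpha> (- (len q * cp \<alpha> \<nu>)) q = Some q'"
  shows "homog q' (\<nu> - cp \<alpha> \<nu> *\<^sub>R \<alpha>)"
proof -
  let ?\<kappa> = "cp \<alpha> \<nu>"
  have split': "e \<alpha> (- (s * ?\<kappa>)) (pre q s) = Some (pre x s) \<and> e \<alpha> (- (u * ?\<kappa>)) (pre q u) = Some (suf x s)"
    if su: "0 < s" "0 < u" "s + u \<le> len q" and x: "e \<alpha> (- ((s + u) * ?\<kappa>)) (pre q (s + u)) = Some x" for s u x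
  proof -
    have pp: "pre (pre q (s + u)) s = pre q s"
      using coassoc[of q s "s + u"] homogD(1)[OF q] su by simp
    note pq = homogD(5,6)[OF q, of "s + u"]
    \<comment> \<open>Epsilon has the same value on both factors and cancels in sigma, whatever that
      value is.\<close>
    have epw: "ep \<alpha> (pre q s) + cp \<alpha> (w (pre q s)) - ep \<alpha> (pre q u) = s * ?\<kappa>"
      using homog_ep_const[OF q \<alpha> less_imp_le[OF \<kappa>], of s] homog_ep_const[OF q \<alpha> less_imp_le[OF \<kappa>], of u]
        homog_ph[OF q \<alpha>, of s] su unfolding ph_def by linarith
    have "0 \<le> s * ?\<kappa>" "0 \<le> u * ?\<kappa>" using su \<kappa> by auto
    then have "share (- ((s + u) * ?\<kappa>)) (s * ?\<kappa>) = - (s * ?\<kappa>)"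
      by (simp add: share_def max_def distrib_right)
    then have c: "- (s * ?\<kappa>) = share (- ((s + u) * ?\<kappa>)) (ep \<alpha> (pre (pre q (s + u)) s) +
        cp \<alpha> (w (pre (pre q (s + u)) s)) - ep \<alpha> (suf (pre q (s + u)) s))"
      unfolding pp homogD(4)[OF q su] epw by simp
    have "- ((s + u) * ?\<kappa>) - - (s * ?\<kappa>) = - (u * ?\<kappa>)" by (simp add: algebra_simps)
    with e_split[OF \<alpha> pq(1) _ _ x c] pq(2) su show ?thesis
      unfolding pp homogD(4)[OF q su] by simp
  qed
  have q': "q' \<in> P" "len q' = len q" using e_Some[OF \<alpha> homogD(1)[OF q] e] by auto
  have pre': "e \<alpha> (- (u * ?\<kappa>)) (pre q u) = Some (pre q' u)" if "0 < u" "u \<le> len q" for u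
  proof (cases "u = len q")
    case True
    then show ?thesis using e pre_len q' homogD(1)[OF q] by metis
  next
    case False
    then show ?thesis
      using split'[of u "len q - u" q'] that e pre_len[OF homogD(1)[OF q]] by simp
  qed
  have "w (pre q' u) = u *\<^sub>R (\<nu> - ?\<kappa> *\<^sub>R \<alpha>)" if "0 \<le> u" "u \<le> len q" for u
  proof (cases "u = 0")
    case True
    then show ?thesis using pre_0 q' top_0 by simp
  next
    case False
    then show ?thesis
      using e_Some[OF \<alpha> homogD(5)[OF q that] pre'] homogD(3)[OF q that] that
      by (simp add: scaleR_diff_right)
  qed
  moreover have "suf (pre q' (s + u)) s = pre q' u" if "0 < s" "0 < u" "s + u \<le> len q" for s u
    using split'[OF that pre'] pre'[of u] that by simp
  ultimately show ?thesis
    using q' homogD(2)[OF q] unfolding homog_def by simp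
qed

subsection \<open>Initial and final factors\<close>

text \<open>A short initial factor is either left alone by the lowering operator or lowered by
  exactly the amount that reflects it. Which case occurs depends on the sign of the pairing and on
  the part of \<open>p\<close> behind the homogeneous factor.\<close>

lemma initial_homog_f:
  assumes p: "p \<in> P" "\<alpha> \<in> \<Sigma>" "0 \<le> r" and e: "e \<alpha> (- r) p = Some p'"
    and s0: "0 < s0" "s0 \<le> len p" and h: "homog (pre p s0) \<nu>"
  shows "\<exists>s \<nu>. 0 < s \<and> s \<le> len p \<and> homog (pre p' s) \<nu>"
proof -
  let ?\<kappa> = "cp \<alpha> \<nu>"
  define q where "q = pre p s0"
  have h: "homog q \<nu>" and lq: "len q = s0" using h split[of p s0] p s0 by (auto simp: q_def)
  have preq: "pre p s = pre q s" if "0 \<le> s" "s \<le> s0" for s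
    using coassoc[of p s s0] p s0 that by (simp add: q_def)
  have pre_suf: "pre (suf p s) (s0 - s) = pre q (s0 - s)" if "0 < s" "s < s0" for s
    using coassoc[of p s s0] p s0 that homog_suf[OF h, of s] lq by (simp add: q_def)
  have suf_suf: "suf (suf p s) (s0 - s) = suf p s0" if "0 < s" "s < s0" for s
    using coassoc[of p s s0] p s0 that by simp
  have unaffected: ?thesis if "0 < s" "s < s0" "ph \<alpha> (pre p s) \<le> ep \<alpha> (suf p s)" for s
    using pre_f_unaffected[OF p(2,1) _ _ p(3) e, of s] that s0 preq[of s] homog_pre[OF h, of s] lq
    by (metis less_imp_le order_trans)
  define X where "X = ep \<alpha> (suf p s0)"
  \<comment> \<open>The suffix from \<open>s\<close> starts with the factor of \<open>q\<close> on
    [s, s0], which homogeneity identifies with \<open>pre q (s0 - s)\<close>.\<close>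
  have ep_suf: "ep \<alpha> (suf p s) = max (ep \<alpha> (pre q (s0 - s))) (X - (s0 - s) * ?\<kappa>)"
    if "0 < s" "s < s0" for s
    using ep_split[OF p(2), of "suf p s" "s0 - s"] split[of p s] pre_suf[OF that] suf_suf[OF that]
      homogD(3)[OF h, of "s0 - s"] p s0 that lq by (simp add: X_def cp_simps)
  show ?thesis
  proof (cases "?\<kappa> \<le> 0")
    case True
    then have "ph \<alpha> (pre q (s0/2)) \<le> ep \<alpha> (pre q (s0/2))"
      using homog_ph[OF h p(2), of "s0/2"] s0 lq by (simp add: mult_nonneg_nonpos)
    also have "\<dots> \<le> ep \<alpha> (suf p (s0/2))"
      using ep_suf[of "s0/2"] s0 by (simp add: field_simps)
    finally show ?thesis using unaffected[of "s0/2"] preq[of "s0/2"] s0 by simp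
  next
    case False
    then have \<kappa>: "0 < ?\<kappa>" by simp
    \<comment> \<open>\<open>A\<close> is the bound that the part behind \<open>s0\<close> puts on
      sigma: for a cut at \<open>s\<close>, sigma is \<open>min (?\<kappa> * s) A\<close>.\<close>
    define d A where "d = ep \<alpha> q" and "A = d + ?\<kappa> * s0 - X"
    have d: "ep \<alpha> (pre q s) = d" if "0 < s" "s \<le> s0" for s
      using homog_ep_const[OF h p(2) less_imp_le[OF \<kappa>]] that lq by (simp add: d_def)
    have sg: "ph \<alpha> (pre p s) - ep \<alpha> (suf p s) = min (?\<kappa> * s) A" if "0 < s" "s < s0" for s
      using homog_ph[OF h p(2), of s] ep_suf[OF that] d[of s] d[of "s0 - s"] preq[of s] that lq
      by (simp add: A_def algebra_simps min_def max_def)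
    show ?thesis
    proof (cases "A \<le> 0 \<or> r = 0")
      case True
      then consider "A \<le> 0" | "r = 0" by blast
      then show ?thesis
      proof cases
        case 1
        then show ?thesis using unaffected[of "s0/2"] sg[of "s0/2"] s0 by (simp add: min_def split: if_splits)
      next
        case 2
        then show ?thesis using e e_zero[OF p(2,1)] s0 h by (auto simp: q_def)
      qed
    next
      case False
      \<comment> \<open>So short that neither \<open>A\<close> nor \<open>r\<close> is smaller than
        \<open>?\<kappa> * s\<close>; the factor then receives exactly the reflecting
        exponent.\<close>
      define s where "s = min (s0/2) (min A r / ?\<kappa>)"
      have s: "0 < s" "s < s0" "?\<kappa> * s \<le> A" "?\<kappa> * s \<le> r"
        using False p(3) s0 \<kappa> by (auto simp: s_def min_def field_simps)
      have "share (- r) (ep \<alpha> (pre p s) + cp \<alpha> (w (pre p s)) - ep \<alpha> (suf p s)) = - (s * ?\<kappa>)"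
        using sg[OF s(1,2)] s p(3) \<kappa> by (simp add: share_nonpos ph_def min_def max_def mult.commute)
      then have "e \<alpha> (- (s * ?\<kappa>)) (pre q s) = Some (pre p' s)"
        using e_split[OF p(2,1) _ _ e, of s] preq[of s] s s0 by simp
      then have "homog (pre p' s) (\<nu> - ?\<kappa> *\<^sub>R \<alpha>)"
        using homog_reflect[OF homog_pre[OF h] p(2) \<kappa>] homogD(6)[OF h] s lq by simp
      then show ?thesis using s s0 by (metis less_imp_le order_trans)
    qed
  qed
qed

lemma initial_homog:
  assumes "p \<in> P" "0 < len p"
  obtains s \<nu> where "0 < s" "s \<le> len p" "homog (pre p s) \<nu>"
proof -
  have "0 < len p \<longrightarrow> (\<exists>s \<nu>. 0 < s \<and> s \<le> len p \<and> homog (pre p s) \<nu>)"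
  proof (rule generated[OF assms(1)])
    fix t :: real assume "0 \<le> t"
    then show "0 < len (top t) \<longrightarrow> (\<exists>s \<nu>. 0 < s \<and> s \<le> len (top t) \<and> homog (pre (top t) s) \<nu>)"
      using top[of t] homog_top[of t] pre_len[of "top t"] by force
  next
    fix q \<alpha> r q'
    assume q: "q \<in> P" "0 < len q \<longrightarrow> (\<exists>s \<nu>. 0 < s \<and> s \<le> len q \<and> homog (pre q s) \<nu>)"
      "\<alpha> \<in> \<Sigma>" "(0::real) \<le> r" "e \<alpha> (- r) q = Some q'"
    show "0 < len q' \<longrightarrow> (\<exists>s \<nu>. 0 < s \<and> s \<le> len q' \<and> homog (pre q' s) \<nu>)"
      using q(2) initial_homog_f[OF q(1,3-5)] e_Some[OF q(3,1,5)] by metis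
  qed
  then show ?thesis using that assms(2) by blast
qed

section \<open>Linear behaviour at the start of a path\<close>

lemma w_pre_linear:
  assumes "p \<in> P" "0 < len p"
  obtains s0 \<nu> where "0 < s0" "s0 \<le> len p" "\<And>s. 0 \<le> s \<Longrightarrow> s \<le> s0 \<Longrightarrow> w (pre p s) = s *\<^sub>R \<nu>"
proof -
  obtain s0 \<nu> where s0: "0 < s0" "s0 \<le> len p" and h: "homog (pre p s0) \<nu>"
    using initial_homog[OF assms] .
  have "w (pre p s) = s *\<^sub>R \<nu>" if "0 \<le> s" "s \<le> s0" for s
    using homogD(3)[OF h that(1)] coassoc[of p s s0] that s0 assms split[of p s0] by simp
  then show ?thesis using that s0 by blast
qed

text \<open>The maximal raising operator raises each initial factor maximally, so the weights of the
  initial factors of \<open>p\<close> and of its maximal raise differ by \<open>ep \<alpha> (pre p s) \<alpha>\<close>.\<close>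

lemma ep_pre_linear:
  assumes "p \<in> P" "0 < len p" "\<alpha> \<in> \<Sigma>"
  obtains s0 K where "0 < s0" "s0 \<le> len p" "\<And>s. 0 \<le> s \<Longrightarrow> s \<le> s0 \<Longrightarrow> ep \<alpha> (pre p s) = s * K"
proof -
  obtain p' where e: "e \<alpha> (ep \<alpha> p) p = Some p'" using e_ep[OF assms(3,1)] by blast
  have p': "p' \<in> P" "len p' = len p" using e_Some[OF assms(3,1) e] by auto
  obtain s1 \<nu>1 where s1: "0 < s1" "s1 \<le> len p" "\<And>s. 0 \<le> s \<Longrightarrow> s \<le> s1 \<Longrightarrow> w (pre p s) = s *\<^sub>R \<nu>1"
    using w_pre_linear[OF assms(1,2)] by blast
  obtain s2 \<nu>2 where s2: "0 < s2" "s2 \<le> len p" "\<And>s. 0 \<le> s \<Longrightarrow> s \<le> s2 \<Longrightarrow> w (pre p' s) = s *\<^sub>R \<nu>2"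
    using w_pre_linear[OF p'(1)] p'(2) assms(2) by metis
  \<comment> \<open>The two linear paths differ by epsilon times the root. Pairing with the coroot,
    which is 2 on the root, gives the slope.\<close>
  have "ep \<alpha> (pre p s) = s * ((cp \<alpha> \<nu>2 - cp \<alpha> \<nu>1) / 2)" if s: "0 \<le> s" "s \<le> min s1 s2" for s
  proof -
    have sl: "s \<le> len p" "s \<le> s1" "s \<le> s2" using s s1 by auto
    note sp = split[OF assms(1) s(1) sl(1)]
    have "share (ep \<alpha> p) (ep \<alpha> (pre p s) + cp \<alpha> (w (pre p s)) - ep \<alpha> (suf p s)) = ep \<alpha> (pre p s)"
      using ep_split'[OF assms(3,1) s(1) sl(1)] ep_nonneg[OF assms(3), of "pre p s"]
        ep_nonneg[OF assms(3), of "suf p s"] sp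
      by (auto simp: share_def ph_def max_def)
    then have "e \<alpha> (ep \<alpha> (pre p s)) (pre p s) = Some (pre p' s)"
      using e_split[OF assms(3,1) s(1) sl(1) e] by simp
    then have "w (pre p' s) = w (pre p s) + ep \<alpha> (pre p s) *\<^sub>R \<alpha>"
      using e_Some[OF assms(3)] sp by blast
    then have "cp \<alpha> (s *\<^sub>R \<nu>2) = cp \<alpha> (s *\<^sub>R \<nu>1 + ep \<alpha> (pre p s) *\<^sub>R \<alpha>)"
      using s1(3)[OF s(1) sl(2)] s2(3)[OF s(1) sl(3)] by simp
    then show ?thesis using cp_self[OF assms(3)] by (simp add: cp_simps[OF assms(3)] algebra_simps)
  qed
  moreover have "0 < min s1 s2" "min s1 s2 \<le> len p" using s1 s2 by auto
  ultimately show ?thesis using that by blast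
qed

text \<open>Epsilon of \<open>pre q s\<close> is constant for \<open>s > 0\<close> and also linear
  near 0. Comparing \<open>s0\<close> with \<open>s0/2\<close> forces slope 0, so the constant is
  0.\<close>

lemma homog_ep_0:
  assumes "homog q \<nu>" "\<alpha> \<in> \<Sigma>" "0 \<le> cp \<alpha> \<nu>" "0 \<le> u" "u \<le> len q"
  shows "ep \<alpha> (pre q u) = 0"
proof (cases "u = 0")
  case True
  then show ?thesis using pre_0 homogD(1)[OF assms(1)] top_0 assms(2) by simp
next
  case False
  obtain s0 K where s0: "0 < s0" "s0 \<le> len q" "\<And>s. 0 \<le> s \<Longrightarrow> s \<le> s0 \<Longrightarrow> ep \<alpha> (pre q s) = s * K"
    using ep_pre_linear[OF homogD(1,2)[OF assms(1)] assms(2)] by blast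
  have "ep \<alpha> (pre q s) = ep \<alpha> q" if "0 < s" "s \<le> len q" for s
    using homog_ep_const[OF assms(1-3) that] .
  from this[of s0] this[of "s0/2"] this[of u] s0(3)[of s0] s0(3)[of "s0/2"] s0(1,2) False assms
  show ?thesis by simp
qed

text \<open>As for \<open>homog_ep_0\<close>: phi is constant for positive lengths and linear near
  0, with slope \<open>K + cp \<alpha> \<nu>\<close>.\<close>

lemma homog_ph_0:
  assumes "homog q \<nu>" "\<alpha> \<in> \<Sigma>" "cp \<alpha> \<nu> \<le> 0" "0 \<le> u" "u \<le> len q"
  shows "ph \<alpha> (pre q u) = 0"
proof (cases "u = 0")
  case True
  then show ?thesis using pre_0 homogD(1)[OF assms(1)] top_0 assms(2) by simp
next
  case False
  obtain s0 K where s0: "0 < s0" "s0 \<le> len q" "\<And>s. 0 \<le> s \<Longrightarrow> s \<le> s0 \<Longrightarrow> ep \<alpha> (pre q s) = s * K"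
    using ep_pre_linear[OF homogD(1,2)[OF assms(1)] assms(2)] by blast
  have "ph \<alpha> (pre q s) = s * (K + cp \<alpha> \<nu>)" if "0 \<le> s" "s \<le> s0" for s
    using homog_ph[OF assms(1,2), of s] s0 that by (simp add: algebra_simps)
  moreover have "ph \<alpha> (pre q s) = ph \<alpha> q" if "0 < s" "s \<le> len q" for s
    using homog_ph_const[OF assms(1-3) that] .
  note this[of s0] this[of "s0/2"] this[of u]
  ultimately show ?thesis using s0(1,2) False assms(4,5) by auto
qed

text \<open>A final factor is reached by lowering only after the part before it is exhausted. So a
  short one is untouched unless \<open>r\<close> is maximal, and in that case the whole homogeneous
  factor is reflected. The vanishing of epsilon or phi on homogeneous factors makes this
  exact.\<close>

lemma final_homog_f:
  assumes p: "p \<in> P" "\<alpha> \<in> \<Sigma>" "0 \<le> r" and e: "e \<alpha> (- r) p = Some p'"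
    and s0: "0 < s0" "s0 \<le> len p" and h: "homog (suf p (len p - s0)) \<nu>"
  shows "\<exists>s \<nu>. 0 < s \<and> s \<le> len p \<and> homog (suf p' (len p - s)) \<nu>"
proof -
  let ?\<kappa> = "cp \<alpha> \<nu>" and ?T = "len p"
  define q where "q = suf p (?T - s0)"
  have h: "homog q \<nu>" and lq: "len q = s0" using h split[of p "?T - s0"] p s0 by (auto simp: q_def)
  have q: "q \<in> P" "pre q s0 = q" using homogD(1)[OF h] pre_len lq by auto
  have sufq: "suf p (?T - s) = pre q s" if "0 < s" "s \<le> s0" for s
    using coassoc[of p "?T - s0" "?T - s"] p s0 that homog_suf[OF h, of "s0 - s"] lq by (simp add: q_def)
  have step: "e \<alpha> (- r - c) (pre q s) = Some (suf p' (?T - s))"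
    if "0 < s" "s \<le> s0" "c = share (- r) (ph \<alpha> (pre p (?T - s)) - ep \<alpha> (pre q s))" for s c
    using e_split[OF p(2,1) _ _ e, of "?T - s" c] sufq[OF that(1,2)] that s0 by (simp add: ph_def)
  show ?thesis
  proof (cases "?\<kappa> \<le> 0")
    case True
    define c where "c = share (- r) (ph \<alpha> (pre p (?T - s0)) - ep \<alpha> (pre q s0))"
    have e': "e \<alpha> (- r - c) q = Some (suf p' (?T - s0))"
      using step[OF s0(1) order_refl c_def] q by simp
    have "- r - c \<le> 0" using p(3) by (simp add: c_def share_nonpos)
    moreover have "ph \<alpha> q = 0" using homog_ph_0[OF h p(2) True, of s0] q lq s0 by simp
    \<comment> \<open>An element with phi 0 admits no nontrivial lowering, so the final factor
      receives exponent 0.\<close>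
    ultimately have "- r - c = 0" using e_range(1)[OF p(2) q(1) e'] by simp
    then have "suf p' (?T - s0) = q" using e' e_zero[OF p(2) q(1)] by (simp only: option.inject)
    then show ?thesis using h s0 by auto
  next
    case False
    then have \<kappa>: "0 < ?\<kappa>" by simp
    have ep0: "ep \<alpha> (pre q s) = 0" "ph \<alpha> (pre q s) = s * ?\<kappa>" if "0 \<le> s" "s \<le> s0" for s
      using homog_ep_0[OF h p(2) less_imp_le[OF \<kappa>], of s] homog_ph[OF h p(2), of s] that lq by auto
    \<comment> \<open>Phi of the part before \<open>q\<close>. Epsilon vanishes on factors of
      \<open>q\<close>, so phi adds up along the splitting.\<close>
    define Y where "Y = ph \<alpha> (pre p (?T - s0))"
    have Y: "0 \<le> Y" using ph_nonneg[OF p(2)] split[of p "?T - s0"] p s0 by (simp add: Y_def)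
    have ph_pre: "ph \<alpha> (pre p (?T - s)) = (s0 - s) * ?\<kappa> + Y" if "0 \<le> s" "s \<le> s0" for s
    proof -
      have "pre (pre p (?T - s)) (?T - s0) = pre p (?T - s0) \<and>
          suf (pre p (?T - s)) (?T - s0) = pre q (s0 - s)"
        using coassoc[of p "?T - s0" "?T - s"] p s0 that by (simp add: q_def)
      then show ?thesis
        using ph_split[OF p(2), of "pre p (?T - s)" "?T - s0"] split[of p "?T - s"] ep0[of "s0 - s"]
          p s0 that Y by (simp add: Y_def)
    qed
    have "ph \<alpha> p = s0 * ?\<kappa> + Y" using ph_pre[of 0] s0 pre_len[OF p(1)] by simp
    then have r: "r \<le> s0 * ?\<kappa> + Y" using e_range(1)[OF p(2,1) e] by simp
    show ?thesis
    proof (cases "r = s0 * ?\<kappa> + Y")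
      case True
      \<comment> \<open>Of the maximal exponent, the part before \<open>q\<close> takes
        \<open>Y\<close>, which leaves \<open>s0 * ?\<kappa>\<close> for \<open>q\<close>.\<close>
      have "e \<alpha> (- (len q * ?\<kappa>)) q = Some (suf p' (?T - s0))"
        using step[OF s0(1) order_refl HOL.refl] ph_pre[of s0] ep0[of s0] Y p(3) s0 \<kappa> lq True q
        by (simp add: share_nonpos)
      from homog_reflect[OF h p(2) \<kappa> this] show ?thesis using s0 by blast
    next
      case False
      \<comment> \<open>Chosen so that phi of the part before the last \<open>s\<close>, which is
        \<open>(s0 - s) * ?\<kappa> + Y\<close>, is still at least \<open>r\<close> and absorbs the
        whole lowering.\<close>
      define s where "s = min s0 ((s0 * ?\<kappa> + Y - r) / ?\<kappa>)"
      have s: "0 < s" "s \<le> s0" using False r s0 \<kappa> by (auto simp: s_def)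
      have "s * ?\<kappa> \<le> s0 * ?\<kappa> + Y - r" using \<kappa> by (simp add: s_def min_def field_simps)
      then have "share (- r) (ph \<alpha> (pre p (?T - s)) - ep \<alpha> (pre q s)) = - r"
        using ph_pre[of s] ep0[of s] s p(3) by (simp add: share_nonpos algebra_simps min_def max_def)
      then have "e \<alpha> 0 (pre q s) = Some (suf p' (?T - s))" using step[OF s HOL.refl] by simp
      then have "suf p' (?T - s) = pre q s"
        using e_zero[OF p(2) homogD(5)[OF h, of s]] s lq by simp
      then show ?thesis using homog_pre[OF h s(1)] s s0 lq by (metis order_trans)
    qed
  qed
qed

lemma final_homog:
  assumes "p \<in> P" "0 < len p"
  obtains s \<nu> where "0 < s" "s \<le> len p" "homog (suf p (len p - s)) \<nu>"
proof -
  have "0 < len p \<longrightarrow> (\<exists>s \<nu>. 0 < s \<and> s \<le> len p \<and> homog (suf p (len p - s)) \<nu>)"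
  proof (rule generated[OF assms(1)])
    fix t :: real assume "0 \<le> t"
    then show "0 < len (top t) \<longrightarrow> (\<exists>s \<nu>. 0 < s \<and> s \<le> len (top t) \<and> homog (suf (top t) (len (top t) - s)) \<nu>)"
      using top[of t] homog_top[of t] suf_0[of "top t"] by force
  next
    fix q \<alpha> r q'
    assume q: "q \<in> P" "0 < len q \<longrightarrow> (\<exists>s \<nu>. 0 < s \<and> s \<le> len q \<and> homog (suf q (len q - s)) \<nu>)"
      "\<alpha> \<in> \<Sigma>" "(0::real) \<le> r" "e \<alpha> (- r) q = Some q'"
    show "0 < len q' \<longrightarrow> (\<exists>s \<nu>. 0 < s \<and> s \<le> len q' \<and> homog (suf q' (len q' - s)) \<nu>)"
      using q(2) final_homog_f[OF q(1,3-5)] e_Some[OF q(3,1,5)] by metis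
  qed
  then show ?thesis using that assms(2) by blast
qed

section \<open>Short initial and final factors, with explicit bounds\<close>

lemma small_pre_homog:
  assumes "p \<in> P"
  obtains d \<nu> where "0 < d" "\<And>s. 0 < s \<Longrightarrow> s < d \<Longrightarrow> s \<le> len p \<Longrightarrow> homog (pre p s) \<nu>"
proof (cases "len p = 0")
  case True
  then show ?thesis using that[of 1] by force
next
  case False
  then obtain s0 \<nu> where s0: "0 < s0" "s0 \<le> len p" "homog (pre p s0) \<nu>"
    using initial_homog assms len_nonneg by (metis order_less_le)
  then have "homog (pre p s) \<nu>" if "0 < s" "s < s0" for s
    using homog_pre[OF s0(3) that(1)] coassoc[of p s s0] that assms split[of p s0] by simp
  then show ?thesis using that s0(1) by blast
qed

lemma small_suf_homog:
  assumes "p \<in> P"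
  obtains d \<nu> where "0 < d" "\<And>s. 0 < s \<Longrightarrow> s < d \<Longrightarrow> s \<le> len p \<Longrightarrow> homog (suf p (len p - s)) \<nu>"
proof (cases "len p = 0")
  case True
  then show ?thesis using that[of 1] by force
next
  case False
  then obtain s0 \<nu> where s0: "0 < s0" "s0 \<le> len p" "homog (suf p (len p - s0)) \<nu>"
    using final_homog assms len_nonneg by (metis order_less_le)
  then have "homog (suf p (len p - s)) \<nu>" if "0 < s" "s < s0" for s
    using homog_pre[OF s0(3) that(1)] homog_suf[OF s0(3), of "s0 - s"] that assms
      coassoc[of p "len p - s0" "len p - s"] split[of p "len p - s0"] by simp
  then show ?thesis using that s0(1) by blast
qed

text \<open>For nonnegative pairing epsilon vanishes; otherwise phi vanishes and epsilon is minus
  the pairing with the weight. This is minus the minimum along a straight path.\<close>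

lemma homog_ep:
  assumes "homog q \<nu>" "\<alpha> \<in> \<Sigma>"
  shows "ep \<alpha> q = max 0 (- (len q * cp \<alpha> \<nu>))"
  using homog_ep_0[OF assms, of "len q"] homog_ph_0[OF assms, of "len q"] homog_ph[OF assms, of "len q"]
    pre_len[OF homogD(1)[OF assms(1)]] homogD(2)[OF assms(1)]
  by (cases "0 \<le> cp \<alpha> \<nu>") (auto simp: max_def mult_nonneg_nonpos not_le mult_pos_neg mult_le_0_iff)

lemma homog_bounds:
  assumes "homog q \<nu>" "\<alpha> \<in> \<Sigma>"
  shows "ep \<alpha> q \<le> len q * \<bar>cp \<alpha> \<nu>\<bar>" "\<bar>cp \<alpha> (w q)\<bar> \<le> len q * \<bar>cp \<alpha> \<nu>\<bar>"
proof -
  have "w q = len q *\<^sub>R \<nu>"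
    using homogD(2)[OF assms(1)] homogD(3)[OF assms(1), of "len q"] pre_len[OF homogD(1)[OF assms(1)]] by simp
  then show "\<bar>cp \<alpha> (w q)\<bar> \<le> len q * \<bar>cp \<alpha> \<nu>\<bar>"
    using homogD(2)[OF assms(1)] by (simp add: cp_simps[OF assms(2)] abs_mult)
  show "ep \<alpha> q \<le> len q * \<bar>cp \<alpha> \<nu>\<bar>"
    using homogD(2)[OF assms(1)] homog_ep[OF assms] mult_left_mono[of "- cp \<alpha> \<nu>" "\<bar>cp \<alpha> \<nu>\<bar>" "len q"] by auto
qed

subsection \<open>The path of an element\<close>

text \<open>The factor of \<open>p\<close> on the interval [a, b], in absolute positions.\<close>

definition cut :: "'p \<Rightarrow> real \<Rightarrow> real \<Rightarrow> 'p" where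
  "cut p a b = pre (suf p a) (b - a)"

text \<open>Coassociativity in interval notation. The last equation exhibits a factor ending at
  \<open>m\<close> as a final factor of \<open>pre p m\<close>.\<close>

lemma cut:
  assumes "p \<in> P" "0 \<le> a" "a \<le> m" "m \<le> b" "b \<le> len p"
  shows "cut p a b \<in> P" "len (cut p a b) = b - a" "pre (cut p a b) (m - a) = cut p a m"
    "suf (cut p a b) (m - a) = cut p m b" "cut p a m = suf (pre p m) a"
proof -
  have a: "suf p a \<in> P" "len (suf p a) = len p - a" using split[of p a] assms by auto
  show "cut p a b \<in> P" "len (cut p a b) = b - a"
    using split[OF a(1), of "b - a"] a(2) assms by (auto simp: cut_def)
  show "pre (cut p a b) (m - a) = cut p a m" "suf (cut p a b) (m - a) = cut p m b"
    using coassoc[OF a(1), of "m - a" "b - a"] coassoc[of p a m] a(2) assms by (auto simp: cut_def)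
  show "cut p a m = suf (pre p m) a"
    using coassoc[of p a m] assms by (simp add: cut_def)
qed

lemma cut_len_0: "p \<in> P \<Longrightarrow> 0 \<le> a \<Longrightarrow> a \<le> len p \<Longrightarrow> cut p a a = top 0"
  using pre_0[of "suf p a"] split[of p a] by (simp add: cut_def)

lemma cut_0: "p \<in> P \<Longrightarrow> cut p 0 m = pre p m"
  by (simp add: cut_def suf_0)

text \<open>The results on final and initial factors, applied to \<open>pre p x\<close> and
  \<open>suf p x\<close>: near each point the path is straight on either side, possibly with a
  corner at \<open>x\<close>.\<close>

lemma cut_homog:
  assumes "p \<in> P" "0 \<le> x" "x \<le> len p"
  obtains d \<nu> \<mu> where "0 < d"
    "\<And>a. 0 \<le> a \<Longrightarrow> a < x \<Longrightarrow> x - a < d \<Longrightarrow> homog (cut p a x) \<nu>"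
    "\<And>b. x < b \<Longrightarrow> b \<le> len p \<Longrightarrow> b - x < d \<Longrightarrow> homog (cut p x b) \<mu>"
proof -
  have x: "pre p x \<in> P" "len (pre p x) = x" "suf p x \<in> P" "len (suf p x) = len p - x"
    using split[OF assms] by auto
  obtain d1 \<nu> where d1: "0 < d1" "\<And>s. 0 < s \<Longrightarrow> s < d1 \<Longrightarrow> s \<le> x \<Longrightarrow> homog (suf (pre p x) (x - s)) \<nu>"
    using small_suf_homog[OF x(1)] x(2) by metis
  obtain d2 \<mu> where d2: "0 < d2" "\<And>s. 0 < s \<Longrightarrow> s < d2 \<Longrightarrow> s \<le> len p - x \<Longrightarrow> homog (pre (suf p x) s) \<mu>"
    using small_pre_homog[OF x(3)] x(4) by metis
  show ?thesis
  proof (rule that)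
    show "0 < min d1 d2" using d1 d2 by simp
    show "homog (cut p a x) \<nu>" if "0 \<le> a" "a < x" "x - a < min d1 d2" for a
      using d1(2)[of "x - a"] cut(5)[of p a x x] assms that by simp
    show "homog (cut p x b) \<mu>" if "x < b" "b \<le> len p" "b - x < min d1 d2" for b
      using d2(2)[of "b - x"] that by (simp add: cut_def)
  qed
qed

text \<open>Cutting at \<open>x\<close> leaves two homogeneous or trivial factors, whose epsilon and
  weights are bounded by a constant times length.\<close>

lemma ep_cut_small:
  assumes "p \<in> P" "\<alpha> \<in> \<Sigma>" "0 < \<delta>" "0 \<le> x" "x \<le> len p"
  shows "\<exists>d>0. \<forall>a b. 0 \<le> a \<and> a \<le> x \<and> x \<le> b \<and> b \<le> len p \<and> b - a < d \<longrightarrow> ep \<alpha> (cut p a b) \<le> \<delta>"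
proof -
  obtain d \<nu> \<mu> where d: "0 < d"
    "\<And>a. 0 \<le> a \<Longrightarrow> a < x \<Longrightarrow> x - a < d \<Longrightarrow> homog (cut p a x) \<nu>"
    "\<And>b. x < b \<Longrightarrow> b \<le> len p \<Longrightarrow> b - x < d \<Longrightarrow> homog (cut p x b) \<mu>"
    using cut_homog[OF assms(1,4,5)] by metis
  \<comment> \<open>One rate for both sides of \<open>x\<close>; the summand 1 keeps it
    positive.\<close>
  define K where "K = \<bar>cp \<alpha> \<nu>\<bar> + \<bar>cp \<alpha> \<mu>\<bar> + 1"
  have "ep \<alpha> (cut p a b) \<le> \<delta>"
    if ab: "0 \<le> a" "a \<le> x" "x \<le> b" "b \<le> len p" "b - a < min d (\<delta> / K)" for a b
  proof -
    have K: "K > 0" "(b - a) * K < \<delta>" using ab(5) by (auto simp: K_def field_simps)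
    have "ep \<alpha> (cut p a x) \<le> (b - a) * K \<and> \<bar>cp \<alpha> (w (cut p a x))\<bar> \<le> (x - a) * \<bar>cp \<alpha> \<nu>\<bar>"
    proof (cases "a = x")
      case True
      then show ?thesis
        using cut_len_0[OF assms(1), of x] assms top_0 cp_simps K ab by simp
    next
      case False
      then have h: "homog (cut p a x) \<nu>" using d(2) ab by simp
      have "(x - a) * \<bar>cp \<alpha> \<nu>\<bar> \<le> (b - a) * K" using ab by (intro mult_mono) (auto simp: K_def)
      then show ?thesis using homog_bounds[OF h assms(2)] cut(2)[OF assms(1) ab(1,2) order_refl assms(5)] by auto
    qed
    moreover have "ep \<alpha> (cut p x b) \<le> (b - x) * \<bar>cp \<alpha> \<mu>\<bar>"
    proof (cases "b = x")
      case True
      then show ?thesis using cut_len_0[OF assms(1), of x] assms top_0 by simp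
    next
      case False
      then have h: "homog (cut p x b) \<mu>" using d(3) ab by simp
      then show ?thesis using homog_bounds[OF h assms(2)] cut(2)[OF assms(1,4) ab(3) order_refl ab(4)] by auto
    qed
    moreover have "(b - x) * \<bar>cp \<alpha> \<mu>\<bar> + (x - a) * \<bar>cp \<alpha> \<nu>\<bar> \<le> (b - a) * K"
    proof -
      have "(b - x) * \<bar>cp \<alpha> \<mu>\<bar> \<le> (b - a) * \<bar>cp \<alpha> \<mu>\<bar>" "(x - a) * \<bar>cp \<alpha> \<nu>\<bar> \<le> (b - a) * \<bar>cp \<alpha> \<nu>\<bar>"
        using ab by (auto intro: mult_right_mono)
      then show ?thesis using ab by (simp add: K_def algebra_simps)
    qed
    ultimately show ?thesis
      using ep_split[OF assms(2) cut(1)[OF assms(1) ab(1-4)], of "x - a"]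
        cut[OF assms(1) ab(1-4)] ab K by (auto simp: max_def)
  qed
  moreover have "0 < min d (\<delta> / K)" using d assms(3) by (simp add: K_def)
  ultimately show ?thesis by blast
qed

text \<open>Bolzano's principle supplies the compactness: the estimate holds on short intervals
  around each point and survives concatenation. The error does not accumulate, because epsilon of a
  tensor product is a maximum, not a sum.\<close>

lemma ep_approx:
  assumes "p \<in> P" "\<alpha> \<in> \<Sigma>" "0 < \<delta>"
  shows "\<exists>s. 0 \<le> s \<and> s \<le> len p \<and> ep \<alpha> p \<le> \<delta> - cp \<alpha> (w (pre p s))"
proof -
  \<comment> \<open>The guard makes \<open>Q\<close> hold trivially on intervals that leave
    \<open>[0, len p]\<close>, as the local condition at an endpoint requires.\<close>
  define Q where "Q a b \<longleftrightarrow> (0 \<le> a \<and> a \<le> b \<and> b \<le> len p \<longrightarrow>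
    (\<exists>m. a \<le> m \<and> m \<le> b \<and> ep \<alpha> (cut p a b) \<le> \<delta> - cp \<alpha> (w (cut p a m))))" for a b
  have "Q 0 (len p)"
  proof (rule Bolzano)
    show "0 \<le> len p" using len_nonneg assms by simp
  next
    fix a b c assume Q: "Q a b" "Q b c" and abc: "a \<le> b" "b \<le> c"
    show "Q a c"
      unfolding Q_def
    proof
      assume v: "0 \<le> a \<and> a \<le> c \<and> c \<le> len p"
      then have v': "0 \<le> a" "c \<le> len p" "b \<le> len p" "0 \<le> b" using abc by auto
      have ep: "ep \<alpha> (cut p a c) = max (ep \<alpha> (cut p a b)) (ep \<alpha> (cut p b c) - cp \<alpha> (w (cut p a b)))"
        using ep_split[OF assms(2) cut(1)[OF assms(1) v'(1) abc v'(2)], of "b - a"]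
          cut[OF assms(1) v'(1) abc v'(2)] abc by simp
      from Q obtain m1 m2 where
        m1: "a \<le> m1" "m1 \<le> b" "ep \<alpha> (cut p a b) \<le> \<delta> - cp \<alpha> (w (cut p a m1))" and
        m2: "b \<le> m2" "m2 \<le> c" "ep \<alpha> (cut p b c) \<le> \<delta> - cp \<alpha> (w (cut p b m2))"
        using v v' abc unfolding Q_def by blast
      have "m2 \<le> len p" using m2 v' by simp
      note cm = cut[OF assms(1) v'(1) abc(1) m2(1) this]
      have "w (cut p a m2) = w (cut p a b) + w (cut p b m2)"
        using split[OF cm(1), of "b - a"] cm abc m2 by simp
      then have "ep \<alpha> (cut p b c) - cp \<alpha> (w (cut p a b)) \<le> \<delta> - cp \<alpha> (w (cut p a m2))"
        using m2 by (simp add: cp_simps[OF assms(2)])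
      then show "\<exists>m. a \<le> m \<and> m \<le> c \<and> ep \<alpha> (cut p a c) \<le> \<delta> - cp \<alpha> (w (cut p a m))"
        using ep m1 m2 abc exI[of _ m1] exI[of _ m2]
        by (smt (verit, best))
    qed
  next
    fix x assume x: "0 \<le> x" "x \<le> len p"
    obtain d where d: "d > 0"
      "\<And>a b. 0 \<le> a \<Longrightarrow> a \<le> x \<Longrightarrow> x \<le> b \<Longrightarrow> b \<le> len p \<Longrightarrow> b - a < d \<Longrightarrow> ep \<alpha> (cut p a b) \<le> \<delta>"
      using ep_cut_small[OF assms x] by blast
    \<comment> \<open>The witness is \<open>m = a\<close>: the factor there is trivial and has
      weight 0.\<close>
    have "Q a b" if "a \<le> x" "x \<le> b" "b - a < d" for a b
      using d(2)[of a b] that cut_len_0[OF assms(1), of a] top_0(3) cp_simps(4)[OF assms(2)]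
      unfolding Q_def by (intro impI exI[of _ a]) auto
    then show "\<exists>d>0. \<forall>a b. a \<le> x \<and> x \<le> b \<and> b - a < d \<longrightarrow> Q a b"
      using d(1) by blast
  qed
  then show ?thesis
    using len_nonneg[OF assms(1)] pre_len[OF assms(1)] unfolding Q_def by (simp add: cut_0[OF assms(1)])
qed

text \<open>Epsilon of an initial factor bounds that of \<open>p\<close> from below, and phi of the
  initial factor is nonnegative.\<close>

lemma ep_ge:
  assumes "p \<in> P" "\<alpha> \<in> \<Sigma>" "0 \<le> s" "s \<le> len p"
  shows "- cp \<alpha> (w (pre p s)) \<le> ep \<alpha> p"
  using ep_split[OF assms(2,1,3,4)] ep_w_nonneg[OF assms(2), of "pre p s"] split[OF assms(1,3,4)] by auto

section \<open>Absence of gaps in strings\<close>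

definition gapless :: "'v \<Rightarrow> 'p \<Rightarrow> bool" where
  "gapless \<alpha> p \<longleftrightarrow> (\<forall>r. 0 \<le> r \<and> r \<le> ph \<alpha> p \<longrightarrow> e \<alpha> (- r) p \<noteq> None)"

text \<open>The tensor rule divides \<open>r\<close> into two exponents, each between 0 and phi of
  its factor; \<open>f_split\<close> then lifts definedness to \<open>p\<close>.\<close>

lemma gapless_split:
  assumes "\<alpha> \<in> \<Sigma>" "p \<in> P" "0 \<le> s" "s \<le> len p" "gapless \<alpha> (pre p s)" "gapless \<alpha> (suf p s)"
  shows "gapless \<alpha> p"
  unfolding gapless_def
proof (intro allI impI)
  fix r assume r: "0 \<le> r \<and> r \<le> ph \<alpha> p"
  define \<sigma> c where "\<sigma> = ph \<alpha> (pre p s) - ep \<alpha> (suf p s)" and "c = min r (max 0 \<sigma>)"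
  have c: "- c = share (- r) (ep \<alpha> (pre p s) + cp \<alpha> (w (pre p s)) - ep \<alpha> (suf p s))"
    using r by (simp add: share_nonpos c_def \<sigma>_def ph_def)
  have "0 \<le> c" "c \<le> ph \<alpha> (pre p s)" "0 \<le> r - c" "r - c \<le> ph \<alpha> (suf p s)"
    using r ph_split[OF assms(1-4)] split[OF assms(2-4)] ph_nonneg[OF assms(1), of "pre p s"]
      ph_nonneg[OF assms(1), of "suf p s"] ep_nonneg[OF assms(1), of "suf p s"]
    by (auto simp: c_def \<sigma>_def)
  then have "e \<alpha> (- c) (pre p s) \<noteq> None" "e \<alpha> (- (r - c)) (suf p s) \<noteq> None"
    using assms(5,6) unfolding gapless_def by blast+
  then show "e \<alpha> (- r) p \<noteq> None"
    using f_split[OF assms(1-4) _ c] r by simp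
qed

lemma gapless_ph_0: "\<alpha> \<in> \<Sigma> \<Longrightarrow> p \<in> P \<Longrightarrow> ph \<alpha> p = 0 \<Longrightarrow> gapless \<alpha> p"
  using e_zero by (auto simp: gapless_def)

text \<open>A partial lowering of a straight element is the full lowering of an initial factor, with
  the remainder fixed. Full lowerings exist by normality.\<close>

lemma homog_gapless:
  assumes h: "homog q \<nu>" and \<alpha>: "\<alpha> \<in> \<Sigma>"
  shows "gapless \<alpha> q"
proof (cases "cp \<alpha> \<nu> \<le> 0")
  case True
  then show ?thesis
    using homog_ph_0[OF h \<alpha> True, of "len q"] pre_len homogD(1,2)[OF h] gapless_ph_0[OF \<alpha>] by simp
next
  case False
  let ?\<kappa> = "cp \<alpha> \<nu>"
  have \<kappa>: "0 < ?\<kappa>" using False by simp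
  note ep0 = homog_ep_0[OF h \<alpha> less_imp_le[OF \<kappa>]]
  have q: "q \<in> P" "pre q (len q) = q" "0 < len q" using homogD(1,2)[OF h] pre_len by auto
  have ph: "ph \<alpha> (pre q s) = s * ?\<kappa>" if "0 \<le> s" "s \<le> len q" for s
    using homog_ph[OF h \<alpha>, of s] ep0[of s] that by simp
  have full: "e \<alpha> (- (s * ?\<kappa>)) (pre q s) \<noteq> None" if "0 \<le> s" "s \<le> len q" for s
    using e_ph[OF \<alpha> homogD(5)[OF h that]] ph[OF that] unfolding ph_def by metis
  show ?thesis
    unfolding gapless_def
  proof (intro allI impI)
    fix r assume r: "0 \<le> r \<and> r \<le> ph \<alpha> q"
    \<comment> \<open>The initial factor of this length has phi equal to \<open>r\<close>.\<close>
    define s where "s = r / ?\<kappa>"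
    have s: "0 \<le> s" "s \<le> len q" "r = s * ?\<kappa>"
      using r ph[of "len q"] q \<kappa> by (auto simp: s_def field_simps)
    show "e \<alpha> (- r) q \<noteq> None"
    proof (cases "s = len q")
      case True
      then show ?thesis using full[OF s(1,2)] s(3) q(2) by simp
    next
      case False
      then have sq: "suf q s = pre q (len q - s)" using homog_suf[OF h s(1)] s(2) by simp
      have qs: "pre q (len q - s) \<in> P" using homogD(5)[OF h, of "len q - s"] s by simp
      have c: "- (s * ?\<kappa>) = share (- r) (ep \<alpha> (pre q s) + cp \<alpha> (w (pre q s)) - ep \<alpha> (suf q s))"
        using ph[OF s(1,2)] ep0[of "len q - s"] s sq r by (simp add: share_nonpos ph_def)
      show ?thesis
        using f_split[OF \<alpha> q(1) s(1,2) _ c full[OF s(1,2)]] r s(3) e_zero[OF \<alpha> qs] sq by simp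
    qed
  qed
qed

text \<open>Homogeneous factors have no gaps and concatenation creates none, so Bolzano's principle
  applies again.\<close>

lemma gapless:
  assumes "p \<in> P" "\<alpha> \<in> \<Sigma>"
  shows "gapless \<alpha> p"
proof -
  define Q where "Q a b \<longleftrightarrow> (0 \<le> a \<and> a \<le> b \<and> b \<le> len p \<longrightarrow> gapless \<alpha> (cut p a b))" for a b
  have trans: "Q a c" if Q: "Q a b" "Q b c" and abc: "a \<le> b" "b \<le> c" for a b c
    unfolding Q_def
  proof
    assume v: "0 \<le> a \<and> a \<le> c \<and> c \<le> len p"
    then have v': "0 \<le> a" "c \<le> len p" by auto
    note c = cut[OF assms(1) v'(1) abc v'(2)]
    show "gapless \<alpha> (cut p a c)"
      using gapless_split[OF assms(2) c(1), of "b - a"] c Q abc v' unfolding Q_def by simp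
  qed
  have "Q 0 (len p)"
  proof (rule Bolzano)
    show "0 \<le> len p" using len_nonneg assms by simp
  next
    fix x assume x: "0 \<le> x" "x \<le> len p"
    have x0: "gapless \<alpha> (cut p x x)"
      using cut_len_0[OF assms(1) x] gapless_ph_0[OF assms(2)] top[of 0] top_0(2)[OF assms(2)] by simp
    obtain d \<nu> \<mu> where d: "0 < d"
      "\<And>a. 0 \<le> a \<Longrightarrow> a < x \<Longrightarrow> x - a < d \<Longrightarrow> homog (cut p a x) \<nu>"
      "\<And>b. x < b \<Longrightarrow> b \<le> len p \<Longrightarrow> b - x < d \<Longrightarrow> homog (cut p x b) \<mu>"
      using cut_homog[OF assms(1) x] by metis
    have "Q a b" if ab: "a \<le> x" "x \<le> b" "b - a < d" for a b
    proof (rule trans[OF _ _ ab(1,2)])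
      show "Q a x"
        using x0 d(2)[of a] homog_gapless assms(2) ab unfolding Q_def by (cases "a = x") auto
      show "Q x b"
        using x0 d(3)[of b] homog_gapless assms(2) ab unfolding Q_def by (cases "b = x") auto
    qed
    then show "\<exists>d>0. \<forall>a b. a \<le> x \<and> x \<le> b \<and> b - a < d \<longrightarrow> Q a b"
      using d(1) by blast
  qed (rule trans)
  then show ?thesis
    using len_nonneg[OF assms(1)] pre_len[OF assms(1)] unfolding Q_def by (simp add: cut_0[OF assms(1)])
qed

text \<open>From the upper end of the string, which exists by normality, one descends without gaps.
  Thus epsilon and phi alone decide which operators are defined.\<close>

lemma e_defined:
  assumes "p \<in> P" "\<alpha> \<in> \<Sigma>"
  shows "e \<alpha> r p \<noteq> None \<longleftrightarrow> - ph \<alpha> p \<le> r \<and> r \<le> ep \<alpha> p"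
proof
  assume "e \<alpha> r p \<noteq> None"
  then show "- ph \<alpha> p \<le> r \<and> r \<le> ep \<alpha> p" using e_range assms by blast
next
  assume r: "- ph \<alpha> p \<le> r \<and> r \<le> ep \<alpha> p"
  obtain p1 where p1: "e \<alpha> (ep \<alpha> p) p = Some p1" using e_ep assms by blast
  have "p1 \<in> P" "ph \<alpha> p1 = ph \<alpha> p + ep \<alpha> p"
    using e_Some[OF assms(2,1) p1] ph_e[OF assms(2,1) p1] by auto
  then have "0 \<le> ep \<alpha> p - r" "ep \<alpha> p - r \<le> ph \<alpha> p1" "gapless \<alpha> p1"
    using gapless assms(2) r by auto
  then have "e \<alpha> (- (ep \<alpha> p - r)) p1 \<noteq> None"
    unfolding gapless_def by blast
  then show "e \<alpha> r p \<noteq> None"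
    using e_add[OF assms(2,1) p1, of "- (ep \<alpha> p - r)"] by simp
qed

lemma e_inverse:
  assumes "\<alpha> \<in> \<Sigma>" "p \<in> P" "e \<alpha> r p = Some p'"
  shows "e \<alpha> (- r) p' = Some p"
  using e_add[OF assms, of "- r"] e_zero[OF assms(1,2)] by simp

end

section \<open>Equality of paths is a bisimulation\<close>

locale two_rays =
  A: crystal_ray \<Sigma> cp lam P len w ep e top pre suf +
  B: crystal_ray \<Sigma> cp lam P' len' w' ep' e' top' pre' suf'
  for \<Sigma> :: "'v::real_vector set" and cp lam
    and P :: "'p set" and len w ep e top pre suf
    and P' :: "'q set" and len' w' ep' e' top' pre' suf'
begin

definition rel :: "'p \<Rightarrow> 'q \<Rightarrow> bool" where
  "rel p q \<longleftrightarrow> p \<in> P \<and> q \<in> P' \<and> len p = len' q \<and>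
     (\<forall>s. 0 \<le> s \<and> s \<le> len p \<longrightarrow> w (pre p s) = w' (pre' q s))"

text \<open>Epsilon is bounded above through the path in one ray (\<open>ep_approx\<close>) and
  below through the same path in the other (\<open>ep_ge\<close>).\<close>

lemma rel_ep_le:
  assumes "rel p q" "\<alpha> \<in> \<Sigma>"
  shows "ep \<alpha> p \<le> ep' \<alpha> q"
proof (rule field_le_epsilon)
  fix \<delta> :: real assume "0 < \<delta>"
  then obtain s where "0 \<le> s" "s \<le> len p" "ep \<alpha> p \<le> \<delta> - cp \<alpha> (w (pre p s))"
    using A.ep_approx[of p \<alpha> \<delta>] assms unfolding rel_def by blast
  then show "ep \<alpha> p \<le> ep' \<alpha> q + \<delta>"
    using B.ep_ge[of q \<alpha> s] assms unfolding rel_def by auto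
qed

end

context two_rays
begin

text \<open>The hypotheses are symmetric in the two rays, so every one-sided result also holds in
  the other direction.\<close>

lemma swap: "two_rays \<Sigma> cp lam P' len' w' ep' e' top' pre' suf' P len w ep e top pre suf"
  by unfold_locales

lemma rel_swap: "two_rays.rel P' len' w' pre' P len w pre q p \<longleftrightarrow> rel p q"
  unfolding two_rays.rel_def[OF swap] rel_def by auto

lemma rel_ep: "rel p q \<Longrightarrow> \<alpha> \<in> \<Sigma> \<Longrightarrow> ep \<alpha> p = ep' \<alpha> q"
  using rel_ep_le two_rays.rel_ep_le[OF swap] rel_swap by (metis order_antisym)

lemma rel_w: "rel p q \<Longrightarrow> w p = w' q"
  using A.pre_len[of p] B.pre_len[of q] A.len_nonneg[of p] unfolding rel_def by fastforce

lemma rel_ph: "rel p q \<Longrightarrow> \<alpha> \<in> \<Sigma> \<Longrightarrow> A.ph \<alpha> p = B.ph \<alpha> q"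
  using rel_w rel_ep by (simp add: A.ph_def B.ph_def)

lemma rel_pre:
  assumes "rel p q" "0 \<le> s" "s \<le> len p"
  shows "rel (pre p s) (pre' q s)"
proof -
  have pq: "p \<in> P" "q \<in> P'" "len' q = len p" "s \<le> len' q" using assms by (auto simp: rel_def)
  have "w (pre (pre p s) u) = w' (pre' (pre' q s) u)" if "0 \<le> u" "u \<le> s" for u
    using A.coassoc[OF pq(1) that assms(3)] B.coassoc[OF pq(2) that pq(4)] assms that
    unfolding rel_def by simp
  then show ?thesis
    using A.split[OF pq(1) assms(2,3)] B.split[OF pq(2) assms(2) pq(4)] unfolding rel_def by simp
qed

text \<open>The path of a suffix is the shifted path minus its value at the cut.\<close>

lemma rel_suf:
  assumes "rel p q" "0 \<le> s" "s \<le> len p"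
  shows "rel (suf p s) (suf' q s)"
proof -
  have pq: "p \<in> P" "q \<in> P'" "len' q = len p" and w: "\<And>u. 0 \<le> u \<Longrightarrow> u \<le> len p \<Longrightarrow> w (pre p u) = w' (pre' q u)"
    using assms by (auto simp: rel_def)
  have "w (pre (suf p s) u) = w' (pre' (suf' q s) u)" if u: "0 \<le> u" "u \<le> len p - s" for u
  proof -
    have "w (pre p (s + u)) = w (pre p s) + w (pre (suf p s) u)"
      using A.split[of "pre p (s + u)" s] A.split[of p "s + u"] A.coassoc[of p s "s + u"] pq assms u by simp
    moreover have "w' (pre' q (s + u)) = w' (pre' q s) + w' (pre' (suf' q s) u)"
      using B.split[of "pre' q (s + u)" s] B.split[of q "s + u"] B.coassoc[of q s "s + u"] pq assms u by simp
    ultimately show ?thesis using w[of s] w[of "s + u"] u assms by simp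
  qed
  moreover have "s \<le> len' q" using pq assms by simp
  ultimately show ?thesis
    using A.split[OF pq(1) assms(2,3)] B.split[OF pq(2) assms(2)] pq(3) unfolding rel_def by simp
qed

text \<open>Definedness depends on epsilon and phi, which the path determines. The exponent on each
  initial factor depends on epsilon and weights of related factors, so the new paths agree as
  well.\<close>

lemma rel_e:
  assumes "rel p q" "\<alpha> \<in> \<Sigma>" "e \<alpha> r p = Some p'"
  obtains q' where "e' \<alpha> r q = Some q'" "rel p' q'"
proof -
  have pq: "p \<in> P" "q \<in> P'" "len' q = len p" using assms by (auto simp: rel_def)
  obtain q' where q': "e' \<alpha> r q = Some q'"
    using A.e_defined[OF pq(1) assms(2), of r] B.e_defined[OF pq(2) assms(2), of r] assms(3)
      rel_ep[OF assms(1,2)] rel_ph[OF assms(1,2)] by fastforce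
  have "w (pre p' s) = w' (pre' q' s)" if s: "0 \<le> s" "s \<le> len p" for s
  proof -
    have sq: "s \<le> len' q" using s pq by simp
    note r = rel_pre[OF assms(1) s] rel_suf[OF assms(1) s]
    define c where "c = share r (ep \<alpha> (pre p s) + cp \<alpha> (w (pre p s)) - ep \<alpha> (suf p s))"
    then have "c = share r (ep' \<alpha> (pre' q s) + cp \<alpha> (w' (pre' q s)) - ep' \<alpha> (suf' q s))"
      using rel_ep[OF r(1) assms(2)] rel_ep[OF r(2) assms(2)] rel_w[OF r(1)] by simp
    then have "e' \<alpha> c (pre' q s) = Some (pre' q' s)"
      using B.e_split[OF assms(2) pq(2) s(1) sq q'] by blast
    moreover have "e \<alpha> c (pre p s) = Some (pre p' s)"
      using A.e_split[OF assms(2) pq(1) s assms(3) c_def] by blast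
    ultimately show ?thesis
      using A.e_Some[OF assms(2)] B.e_Some[OF assms(2)] rel_w[OF r(1)] r(1) unfolding rel_def by metis
  qed
  then have "rel p' q'"
    using A.e_Some[OF assms(2) pq(1) assms(3)] B.e_Some[OF assms(2) pq(2) q'] pq unfolding rel_def by auto
  then show ?thesis using that q' by blast
qed

lemma rel_exists:
  assumes "p \<in> P"
  shows "\<exists>q. rel p q"
proof (rule A.generated[OF assms])
  fix t :: real assume t: "0 \<le> t"
  have "w (pre (top t) s) = w' (pre' (top' t) s)" if "0 \<le> s" "s \<le> t" for s
    using A.split_top[OF that] B.split_top[OF that] A.top[OF that(1)] B.top[OF that(1)] by simp
  then show "\<exists>q. rel (top t) q"
    using A.top[OF t] B.top[OF t] unfolding rel_def by (intro exI[of _ "top' t"]) simp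
next
  fix p \<alpha> r p'
  assume "\<exists>q. rel p q" "\<alpha> \<in> \<Sigma>" "e \<alpha> (- r) p = Some p'"
  then show "\<exists>q. rel p' q" using rel_e by metis
qed

text \<open>A partner of a top has every epsilon 0 and is the top of its length. For a lowered
  element, both partners are raised back, identified by the induction hypothesis, and lowered again
  by \<open>e_inverse\<close>.\<close>

lemma rel_unique:
  assumes "rel p q" "rel p q2"
  shows "q = q2"
proof -
  have "p \<in> P" using assms by (simp add: rel_def)
  then have "\<forall>q q2. rel p q \<longrightarrow> rel p q2 \<longrightarrow> q = q2"
  proof (rule A.generated)
    fix t :: real assume t: "0 \<le> t"
    have "q = top' t" if "rel (top t) q" for q
      using B.top_unique[of q] rel_ep[OF that] A.ep_top[OF _ t] A.top[OF t] that unfolding rel_def by auto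
    then show "\<forall>q q2. rel (top t) q \<longrightarrow> rel (top t) q2 \<longrightarrow> q = q2" by blast
  next
    fix p \<alpha> r p'
    assume p: "p \<in> P" and IH: "\<forall>q q2. rel p q \<longrightarrow> rel p q2 \<longrightarrow> q = q2"
      and \<alpha>: "\<alpha> \<in> \<Sigma>" and e: "e \<alpha> (- r) p = Some p'"
    have e1: "e \<alpha> r p' = Some p" using A.e_inverse[OF \<alpha> p e] by simp
    show "\<forall>q q2. rel p' q \<longrightarrow> rel p' q2 \<longrightarrow> q = q2"
    proof (intro allI impI)
      fix q q2 assume r: "rel p' q" "rel p' q2"
      obtain x where x: "e' \<alpha> r q = Some x" "rel p x" using rel_e[OF r(1) \<alpha> e1] .
      obtain y where y: "e' \<alpha> r q2 = Some y" "rel p y" using rel_e[OF r(2) \<alpha> e1] .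
      have "x = y" using IH x y by blast
      moreover have "q \<in> P'" "q2 \<in> P'" using r by (auto simp: rel_def)
      ultimately show "q = q2" using B.e_inverse[OF \<alpha> _ x(1)] B.e_inverse[OF \<alpha> _ y(1)] by simp
    qed
  qed
  then show ?thesis using assms by blast
qed

end

section \<open>Normal crystals and tensor products\<close>

text \<open>The premise on the ghost ensures that a word with a value in the crystal never passes
  through the ghost.\<close>

lemma f_orbit_induct [consumes 1, case_names ghost base step]:
  assumes "c \<in> f_orbit \<Sigma> B b"
    and ghost: "\<And>\<alpha> r. \<alpha> \<in> \<Sigma> \<Longrightarrow> eop B \<alpha> r None = None"
    and base: "Q b"
    and step: "\<And>x \<alpha> r y. Q x \<Longrightarrow> x \<in> f_orbit \<Sigma> B b \<Longrightarrow> \<alpha> \<in> \<Sigma> \<Longrightarrow> 0 \<le> r \<Longrightarrow>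
      eop B \<alpha> (- r) (Some x) = Some y \<Longrightarrow> Q y"
  shows "Q c"
proof -
  obtain ws where "set ws \<subseteq> \<Sigma> \<times> {0..}" "foldr (\<lambda>(\<alpha>, r). fop B \<alpha> r) ws (Some b) = Some c"
    using assms(1) unfolding f_orbit_def by blast
  then show ?thesis
  proof (induction ws arbitrary: c)
    case Nil
    then show ?case using base by simp
  next
    case (Cons a ws)
    obtain \<alpha> r where a: "a = (\<alpha>, r)" "\<alpha> \<in> \<Sigma>" "0 \<le> r" using Cons.prems(1) by auto
    then obtain x where x: "foldr (\<lambda>(\<alpha>, r). fop B \<alpha> r) ws (Some b) = Some x"
      "eop B \<alpha> (- r) (Some x) = Some c"
      using Cons.prems(2) ghost
      by (cases "foldr (\<lambda>(\<alpha>, r). fop B \<alpha> r) ws (Some b)") (auto simp: fop_def)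
    moreover have "x \<in> f_orbit \<Sigma> B b"
      using x(1) Cons.prems(1) unfolding f_orbit_def by auto
    ultimately show ?case using Cons.IH[of x] Cons.prems(1) a step by auto
  qed
qed

lemma f_orbit_base: "b \<in> f_orbit \<Sigma> B b"
  unfolding f_orbit_def by (intro CollectI exI[of _ "[]"]) simp

lemma f_orbit_step:
  assumes "x \<in> f_orbit \<Sigma> B b" "\<alpha> \<in> \<Sigma>" "0 \<le> r" "eop B \<alpha> (- r) (Some x) = Some y"
  shows "y \<in> f_orbit \<Sigma> B b"
proof -
  obtain ws where ws: "set ws \<subseteq> \<Sigma> \<times> {0..}" "foldr (\<lambda>(\<alpha>, r). fop B \<alpha> r) ws (Some b) = Some x"
    using assms(1) unfolding f_orbit_def by blast
  then have "set ((\<alpha>, r) # ws) \<subseteq> \<Sigma> \<times> {0..} \<and>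
      foldr (\<lambda>(\<alpha>, r). fop B \<alpha> r) ((\<alpha>, r) # ws) (Some b) = Some y"
    using assms(2-4) by (simp add: fop_def)
  then show ?thesis unfolding f_orbit_def by blast
qed

text \<open>By (C1) the choice of \<open>s\<close> is immaterial on weights of a crystal whose \<open>\<epsilon>\<close> and \<open>\<phi>\<close> are finite.\<close>

definition root_pairing :: "'w set \<Rightarrow> ('w \<Rightarrow> 'v) \<Rightarrow> ('w \<Rightarrow> 'v \<Rightarrow> real) \<Rightarrow> 'v \<Rightarrow> 'v \<Rightarrow> real" where
  "root_pairing S sroot coroot \<alpha> = coroot (SOME s. s \<in> S \<and> sroot s = \<alpha>)"

lemma root_pairing:
  assumes "\<alpha> \<in> simple_roots S sroot"
  obtains s where "s \<in> S" "\<alpha> = sroot s" "root_pairing S sroot coroot \<alpha> = coroot s"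
proof -
  define s where "s = (SOME s. s \<in> S \<and> sroot s = \<alpha>)"
  have "\<exists>s. s \<in> S \<and> sroot s = \<alpha>" using assms by (auto simp: simple_roots_def)
  then have "s \<in> S \<and> sroot s = \<alpha>"
    unfolding s_def by (rule someI_ex)
  moreover have "root_pairing S sroot coroot \<alpha> = coroot s"
    unfolding root_pairing_def s_def ..
  ultimately show ?thesis using that by metis
qed

section \<open>Normal crystals with real-valued epsilon\<close>

definition real_eps :: "('b, 'v) crystal \<Rightarrow> 'v \<Rightarrow> 'b \<Rightarrow> real" where
  "real_eps B \<alpha> b = real_of_ereal (eps B \<alpha> b)"

locale normal_cc =
  fixes S :: "'w set" and sroot :: "'w \<Rightarrow> 'v::real_vector" and coroot :: "'w \<Rightarrow> 'v \<Rightarrow> real"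
    and B :: "('b, 'v) crystal"
  assumes cc: "continuous_crystal S sroot coroot B"
    and nc: "normal_crystal (simple_roots S sroot) B"
begin

abbreviation "\<Sigma> \<equiv> simple_roots S sroot"
abbreviation "cp \<equiv> root_pairing S sroot coroot"

lemmas cc_conj = cc[unfolded continuous_crystal_def]

lemma eop_None: "\<alpha> \<in> \<Sigma> \<Longrightarrow> eop B \<alpha> r None = None"
  by (rule cc_conj[THEN conjunct2, THEN conjunct2, THEN conjunct2, THEN conjunct1, rule_format])

lemma eop_0: "\<alpha> \<in> \<Sigma> \<Longrightarrow> b \<in> carrier B \<Longrightarrow> eop B \<alpha> 0 (Some b) = Some b"
  by (rule cc_conj[THEN conjunct2, THEN conjunct2, THEN conjunct2, THEN conjunct2, THEN conjunct1, rule_format])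

lemma eop_add:
  assumes "\<alpha> \<in> \<Sigma>" "b \<in> carrier B" "eop B \<alpha> r (Some b) = Some c"
  shows "eop B \<alpha> (s + r) (Some b) = eop B \<alpha> s (Some c)"
proof -
  have "eop B \<alpha> r (Some b) \<noteq> None" using assms(3) by simp
  from cc_conj[THEN conjunct2, THEN conjunct2, THEN conjunct2, THEN conjunct2, THEN conjunct2,
      THEN conjunct1, rule_format, OF assms(1,2) this]
  show ?thesis using assms(3) by simp
qed

lemma eop_carrier:
  assumes "\<alpha> \<in> \<Sigma>" "b \<in> carrier B" "eop B \<alpha> r (Some b) = Some c"
  shows "c \<in> carrier B"
proof -
  have "eop B \<alpha> r (Some b) \<in> with_ghost B"
    using cc_conj[THEN conjunct1] assms(1,2) by blast
  then show ?thesis using assms(3) by (auto simp: with_ghost_def)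
qed

lemma eps_real:
  assumes "\<alpha> \<in> \<Sigma>" "b \<in> carrier B"
  shows "eps B \<alpha> b = ereal (real_eps B \<alpha> b)" "0 \<le> real_eps B \<alpha> b" "eop B \<alpha> (real_eps B \<alpha> b) (Some b) \<noteq> None"
    "0 \<le> r \<Longrightarrow> eop B \<alpha> r (Some b) \<noteq> None \<Longrightarrow> r \<le> real_eps B \<alpha> b"
proof -
  have "is_max {r. r \<ge> 0 \<and> eop B \<alpha> r (Some b) \<noteq> None} (eps B \<alpha> b)"
    using nc assms unfolding normal_crystal_def by blast
  then show "eps B \<alpha> b = ereal (real_eps B \<alpha> b)" "0 \<le> real_eps B \<alpha> b" "eop B \<alpha> (real_eps B \<alpha> b) (Some b) \<noteq> None"
    "0 \<le> r \<Longrightarrow> eop B \<alpha> r (Some b) \<noteq> None \<Longrightarrow> r \<le> real_eps B \<alpha> b"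
    unfolding is_max_def real_eps_def by auto
qed

lemma phi_real:
  assumes "\<alpha> \<in> \<Sigma>" "b \<in> carrier B"
  shows "phi B \<alpha> b = ereal (real_eps B \<alpha> b + cp \<alpha> (wt B b))" "0 \<le> real_eps B \<alpha> b + cp \<alpha> (wt B b)"
    "eop B \<alpha> (- (real_eps B \<alpha> b + cp \<alpha> (wt B b))) (Some b) \<noteq> None"
proof -
  obtain s where s: "s \<in> S" "\<alpha> = sroot s" "cp \<alpha> = coroot s" using root_pairing[OF assms(1)] .
  have "phi B (sroot s) b = eps B (sroot s) b + ereal (coroot s (wt B b))"
    using cc_conj[THEN conjunct2, THEN conjunct1] s(1) assms(2) by blast
  then show phi: "phi B \<alpha> b = ereal (real_eps B \<alpha> b + cp \<alpha> (wt B b))"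
    using s(2,3) eps_real(1)[OF assms] by simp
  have "is_max {r. r \<ge> 0 \<and> eop B \<alpha> (- r) (Some b) \<noteq> None} (phi B \<alpha> b)"
    using nc assms unfolding normal_crystal_def by blast
  then show "0 \<le> real_eps B \<alpha> b + cp \<alpha> (wt B b)"
    "eop B \<alpha> (- (real_eps B \<alpha> b + cp \<alpha> (wt B b))) (Some b) \<noteq> None"
    unfolding is_max_def phi by auto
qed

lemma eop_Some:
  assumes "\<alpha> \<in> \<Sigma>" "b \<in> carrier B" "eop B \<alpha> r (Some b) = Some c"
  shows "real_eps B \<alpha> c = real_eps B \<alpha> b - r" "wt B c = wt B b + r *\<^sub>R \<alpha>"
proof -
  have "eps B \<alpha> c = eps B \<alpha> b - ereal r \<and> wt B c = wt B b + r *\<^sub>R \<alpha>"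
    using cc_conj[THEN conjunct2, THEN conjunct2, THEN conjunct1, rule_format, OF assms] by simp
  then show "real_eps B \<alpha> c = real_eps B \<alpha> b - r" "wt B c = wt B b + r *\<^sub>R \<alpha>"
    using eps_real(1)[OF assms(1,2)] eps_real(1)[OF assms(1) eop_carrier[OF assms]] by auto
qed

lemma real_eps_highest:
  assumes "highest_weight_element \<Sigma> B lam b" "\<alpha> \<in> \<Sigma>"
  shows "real_eps B \<alpha> b = 0"
proof (rule ccontr)
  have b: "b \<in> carrier B" "\<And>r. r > 0 \<Longrightarrow> eop B \<alpha> r (Some b) = None"
    using assms by (auto simp: highest_weight_element_def)
  assume "real_eps B \<alpha> b \<noteq> 0"
  then have "real_eps B \<alpha> b > 0" using eps_real(2)[OF assms(2) b(1)] by simp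
  then show False using b(2)[of "real_eps B \<alpha> b"] eps_real(3)[OF assms(2) b(1)] by simp
qed

text \<open>The invariant is that of \<open>top_unique\<close>. It serves to recognize the image of
  a tensor product of highest weight elements under an isomorphism.\<close>

lemma highest_unique:
  assumes "highest_weight_element \<Sigma> B lam b" "c \<in> carrier B" "\<And>\<alpha>. \<alpha> \<in> \<Sigma> \<Longrightarrow> real_eps B \<alpha> c = 0"
  shows "c = b"
proof -
  have b: "b \<in> carrier B" "carrier B = f_orbit \<Sigma> B b"
    using assms(1) by (auto simp: highest_weight_element_def)
  have "c \<in> f_orbit \<Sigma> B b" using assms(2) b by simp
  then have "c = b \<or> (\<exists>\<alpha>\<in>\<Sigma>. real_eps B \<alpha> c > 0)"
  proof (induction rule: f_orbit_induct)
    case (step x \<alpha> r y)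
    then have x: "x \<in> carrier B" using b by simp
    show ?case
    proof (cases "r = 0")
      case True
      then show ?thesis using step eop_0[OF step(3) x] by simp
    next
      case False
      then have "real_eps B \<alpha> y > 0"
        using eop_Some(1)[OF step(3) x step(5)] eps_real(2)[OF step(3) x] step(4) by simp
      then show ?thesis using step(3) by blast
    qed
  qed (use eop_None in auto)
  then show ?thesis using assms(3) by force
qed

end

definition tensor_share ::
  "('v \<Rightarrow> 'v \<Rightarrow> real) \<Rightarrow> ('b, 'v) crystal \<Rightarrow> ('c, 'v) crystal \<Rightarrow> 'v \<Rightarrow> real \<Rightarrow> 'b \<Rightarrow> 'c \<Rightarrow> real" where
  "tensor_share cp B1 B2 \<alpha> r b1 b2 = share r (real_eps B1 \<alpha> b1 + cp \<alpha> (wt B1 b1) - real_eps B2 \<alpha> b2)"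

text \<open>For normal factors sigma is finite, so the extended real formulas become real ones and
  \<open>tensor_share\<close> is the exponent on the first factor.\<close>

lemma tensor_normal:
  assumes "normal_cc S sroot coroot B1" "normal_cc S sroot coroot B2"
    and "\<alpha> \<in> simple_roots S sroot" "b1 \<in> carrier B1" "b2 \<in> carrier B2"
  defines "cp \<equiv> root_pairing S sroot coroot"
  defines "c \<equiv> \<lambda>r. tensor_share cp B1 B2 \<alpha> r b1 b2"
  shows "real_eps (tensor B1 B2) \<alpha> (b1, b2) = max (real_eps B1 \<alpha> b1) (real_eps B2 \<alpha> b2 - cp \<alpha> (wt B1 b1))"
    and "eop (tensor B1 B2) \<alpha> r (Some (b1, b2)) = Some (c1, c2) \<longleftrightarrow>
      eop B1 \<alpha> (c r) (Some b1) = Some c1 \<and> eop B2 \<alpha> (r - c r) (Some b2) = Some c2"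
proof -
  define \<sigma> where "\<sigma> = real_eps B1 \<alpha> b1 + cp \<alpha> (wt B1 b1) - real_eps B2 \<alpha> b2"
  note eps = normal_cc.eps_real(1)[OF assms(1,3,4)] normal_cc.eps_real(1)[OF assms(2,3,5)]
  have \<sigma>: "tensor_sigma B1 B2 \<alpha> b1 b2 = ereal \<sigma>"
    using normal_cc.phi_real(1)[OF assms(1,3,4)] eps by (simp add: tensor_sigma_def \<sigma>_def cp_def)
  show "real_eps (tensor B1 B2) \<alpha> (b1, b2) = max (real_eps B1 \<alpha> b1) (real_eps B2 \<alpha> b2 - cp \<alpha> (wt B1 b1))"
    unfolding real_eps_def[of "tensor B1 B2"] using eps
    by (simp add: tensor_def \<sigma> zero_ereal_def max_def) (auto simp: \<sigma>_def)
  have r1: "real_of_ereal (max (ereal r) (- ereal \<sigma>) - max 0 (- ereal \<sigma>)) = c r"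
    by (simp add: c_def tensor_share_def share_def \<sigma>_def[symmetric] zero_ereal_def max_def)
  have r2: "real_of_ereal (min (ereal r) (- ereal \<sigma>) + max 0 (ereal \<sigma>)) = r - c r"
    by (simp add: c_def tensor_share_def share_def \<sigma>_def[symmetric] zero_ereal_def max_def min_def)
  show "eop (tensor B1 B2) \<alpha> r (Some (b1, b2)) = Some (c1, c2) \<longleftrightarrow>
      eop B1 \<alpha> (c r) (Some b1) = Some c1 \<and> eop B2 \<alpha> (r - c r) (Some b2) = Some c2"
    by (simp add: tensor_def Let_def \<sigma> r1[unfolded uminus_ereal.simps] r2[unfolded uminus_ereal.simps]
        split: option.splits)
qed

section \<open>Closed families\<close>

lemma crystal_morphismD:
  assumes "crystal_morphism \<Sigma> B1 B2 \<psi>"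
  shows "x \<in> with_ghost B1 \<Longrightarrow> \<psi> x \<in> with_ghost B2" "\<psi> None = None"
    "b \<in> carrier B1 \<Longrightarrow> \<psi> (Some b) = Some c \<Longrightarrow> wt B2 c = wt B1 b"
    "b \<in> carrier B1 \<Longrightarrow> \<psi> (Some b) = Some c \<Longrightarrow> \<alpha> \<in> \<Sigma> \<Longrightarrow> eps B2 \<alpha> c = eps B1 \<alpha> b"
    "b \<in> carrier B1 \<Longrightarrow> \<alpha> \<in> \<Sigma> \<Longrightarrow> eop B1 \<alpha> r (Some b) \<noteq> None \<Longrightarrow>
      eop B2 \<alpha> r (\<psi> (Some b)) = \<psi> (eop B1 \<alpha> r (Some b))"
  using assms unfolding crystal_morphism_def by blast+

locale closed_normal_family =
  fixes S :: "'w set" and sroot :: "'w \<Rightarrow> 'v::real_vector" and coroot :: "'w \<Rightarrow> 'v \<Rightarrow> real"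
    and B :: "'v \<Rightarrow> ('b, 'v) crystal"
  assumes coroot_linear: "s \<in> S \<Longrightarrow> linear (coroot s)"
    and coroot_root: "s \<in> S \<Longrightarrow> coroot s (sroot s) = 2"
    and closed: "closed_family S sroot coroot B"
    and normal: "lam \<in> closed_chamber S coroot \<Longrightarrow> normal_crystal (simple_roots S sroot) (B lam)"
begin

abbreviation "\<Sigma> \<equiv> simple_roots S sroot"
abbreviation "C \<equiv> closed_chamber S coroot"
abbreviation "cp \<equiv> root_pairing S sroot coroot"

lemma cp: "\<alpha> \<in> \<Sigma> \<Longrightarrow> linear (cp \<alpha>) \<and> cp \<alpha> \<alpha> = 2"
  using coroot_linear coroot_root by (metis root_pairing)

lemma normal_cc: "lam \<in> C \<Longrightarrow> normal_cc S sroot coroot (B lam)"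
  using closed normal by unfold_locales (auto simp: closed_family_def Let_def)

definition hw :: "'v \<Rightarrow> 'b" where
  "hw lam = (SOME b. highest_weight_element \<Sigma> (B lam) lam b)"

lemma hw:
  assumes "lam \<in> C"
  shows "highest_weight_element \<Sigma> (B lam) lam (hw lam)"
proof -
  have "\<exists>b. highest_weight_element \<Sigma> (B lam) lam b"
    using closed assms unfolding closed_family_def highest_weight_crystal_def by (simp add: Let_def)
  then show ?thesis unfolding hw_def by (rule someI_ex)
qed

lemma hw': "lam \<in> C \<Longrightarrow> hw lam \<in> carrier (B lam) \<and> wt (B lam) (hw lam) = lam"
  using hw[of lam] unfolding highest_weight_element_def by blast

section \<open>Splitting maps obtained from closedness\<close>

lemma chamber_add: "lam \<in> C \<Longrightarrow> mu \<in> C \<Longrightarrow> lam + mu \<in> C"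
  using coroot_linear by (auto simp: closed_chamber_def linear_add)

lemma chamber_scale: "lam \<in> C \<Longrightarrow> 0 \<le> t \<Longrightarrow> t *\<^sub>R lam \<in> C"
  using coroot_linear by (auto simp: closed_chamber_def linear_scale)

text \<open>\<open>\<delta>\<close> models the inverse of the isomorphism in a closed family, viewed
  as a map into the whole tensor product instead of the orbit.\<close>

definition splitting :: "'v \<Rightarrow> 'v \<Rightarrow> ('b \<Rightarrow> 'b \<times> 'b) \<Rightarrow> bool" where
  "splitting lam mu \<delta> \<longleftrightarrow> \<delta> (hw (lam + mu)) = (hw lam, hw mu) \<and>
     (\<forall>p\<in>carrier (B (lam + mu)).
        \<delta> p \<in> carrier (B lam) \<times> carrier (B mu) \<and>
        wt (B (lam + mu)) p = wt (tensor (B lam) (B mu)) (\<delta> p) \<and>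
        (\<forall>\<alpha>\<in>\<Sigma>. real_eps (B (lam + mu)) \<alpha> p = real_eps (tensor (B lam) (B mu)) \<alpha> (\<delta> p) \<and>
           (\<forall>r p'. eop (B (lam + mu)) \<alpha> r (Some p) = Some p' \<longrightarrow>
              eop (tensor (B lam) (B mu)) \<alpha> r (Some (\<delta> p)) = Some (\<delta> p')) \<and>
           (\<forall>r\<ge>0. eop (tensor (B lam) (B mu)) \<alpha> (- r) (Some (\<delta> p)) \<noteq> None \<longrightarrow>
              eop (B (lam + mu)) \<alpha> (- r) (Some p) \<noteq> None)))"

lemma splitting_exists:
  assumes "lam \<in> C" "mu \<in> C"
  shows "\<exists>\<delta>. splitting lam mu \<delta>"
proof -
  define T where "T = tensor (B lam) (B mu)"
  define Orb where "Orb = f_orbit \<Sigma> T (hw lam, hw mu)"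
  define F where "F = subcrystal T Orb"
  let ?D = "B (lam + mu)"
  interpret L: normal_cc S sroot coroot "B lam" using normal_cc assms by simp
  interpret M: normal_cc S sroot coroot "B mu" using normal_cc assms by simp
  interpret D: normal_cc S sroot coroot ?D using normal_cc chamber_add assms by simp
  note tensor = tensor_normal[OF L.normal_cc_axioms M.normal_cc_axioms, folded T_def]
  have "crystal_isomorphic \<Sigma> F ?D"
    using closed assms hw[OF assms(1)] hw[OF assms(2)]
    unfolding closed_family_def F_def Orb_def T_def by (simp add: Let_def)
  then obtain \<psi> \<chi> where morph: "crystal_morphism \<Sigma> F ?D \<psi>" "crystal_morphism \<Sigma> ?D F \<chi>"
    and inv: "\<And>x. x \<in> with_ghost F \<Longrightarrow> \<chi> (\<psi> x) = x" "\<And>y. y \<in> with_ghost ?D \<Longrightarrow> \<psi> (\<chi> y) = y"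
    unfolding crystal_isomorphic_def by blast
  note \<psi> = crystal_morphismD[OF morph(1)] and \<chi> = crystal_morphismD[OF morph(2)]
  have carrier_F: "carrier F = Orb" "wt F = wt T" "eps F = eps T" by (auto simp: F_def subcrystal_def)
  have eop_F: "eop F \<alpha> r x = (case eop T \<alpha> r x of None \<Rightarrow> None | Some c \<Rightarrow> if c \<in> Orb then Some c else None)"
    for \<alpha> r x by (simp add: F_def subcrystal_def)
  have Orb_carrier: "c \<in> carrier (B lam) \<times> carrier (B mu)" if "c \<in> Orb" for c
    using that unfolding Orb_def
  proof (induction rule: f_orbit_induct)
    case (step x \<alpha> r y)
    then obtain x1 x2 y1 y2 where "x = (x1, x2)" "y = (y1, y2)" by (metis surj_pair)
    with step tensor(2)[OF step(3), of x1 x2 "- r" y1 y2] show ?case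
      using L.eop_carrier[OF step(3)] M.eop_carrier[OF step(3)] by blast
  qed (use hw' assms in \<open>auto simp: T_def tensor_def\<close>)
  \<comment> \<open>An element sent to the ghost by \<open>\<chi>\<close> would be sent back to the
    ghost by \<open>\<psi>\<close>.\<close>
  have some: "\<exists>c\<in>Orb. \<chi> (Some p) = Some c" if "p \<in> carrier ?D" for p
  proof -
    have "Some p \<in> with_ghost ?D" using that by (simp add: with_ghost_def)
    then have "\<chi> (Some p) \<in> with_ghost F" "\<psi> (\<chi> (Some p)) = Some p"
      using \<chi>(1) inv(2) by auto
    then show ?thesis using \<psi>(2) by (auto simp: with_ghost_def carrier_F)
  qed
  define \<delta> where "\<delta> p = the (\<chi> (Some p))" for p
  have \<delta>: "\<chi> (Some p) = Some (\<delta> p)" "\<delta> p \<in> Orb" if "p \<in> carrier ?D" for p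
    using some[OF that] by (auto simp: \<delta>_def)
  \<comment> \<open>The image of the tensor product of highest weight elements has every epsilon 0,
    because \<open>lam\<close> pairs nonnegatively with the coroots. Hence it is
    \<open>hw (lam + mu)\<close>.\<close>
  have top: "\<delta> (hw (lam + mu)) = (hw lam, hw mu)"
  proof -
    let ?b = "(hw lam, hw mu)"
    have b: "?b \<in> carrier F" "Some ?b \<in> with_ghost F"
      using f_orbit_base[of ?b \<Sigma> T, folded Orb_def] by (auto simp: carrier_F with_ghost_def)
    have "\<psi> (Some ?b) \<in> with_ghost ?D" using \<psi>(1) b(2) .
    moreover have "\<psi> (Some ?b) \<noteq> None"
      using inv(1)[OF b(2)] \<chi>(2) by (metis option.distinct(1))
    ultimately obtain d where d: "\<psi> (Some ?b) = Some d" "d \<in> carrier ?D"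
      by (auto simp: with_ghost_def)
    have "real_eps ?D \<alpha> d = 0" if "\<alpha> \<in> \<Sigma>" for \<alpha>
    proof -
      have "eps ?D \<alpha> d = eps F \<alpha> ?b"
        using \<psi>(4)[OF b(1) d(1) that] .
      then have "real_eps ?D \<alpha> d = real_eps T \<alpha> ?b" by (simp add: real_eps_def carrier_F)
      also have "\<dots> = max (real_eps (B lam) \<alpha> (hw lam)) (real_eps (B mu) \<alpha> (hw mu) - cp \<alpha> (wt (B lam) (hw lam)))"
        using tensor(1)[OF that] hw' assms by blast
      also have "\<dots> = 0"
        using L.real_eps_highest[OF hw[OF assms(1)] that] M.real_eps_highest[OF hw[OF assms(2)] that]
          L.phi_real(2)[OF that, of "hw lam"] hw' assms by simp
      finally show ?thesis .
    qed
    then have "d = hw (lam + mu)"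
      using D.highest_unique[OF hw d(2)] chamber_add[OF assms] by simp
    then show ?thesis using inv(1)[OF b(2)] d(1) by (simp add: \<delta>_def)
  qed
  have carrier: "\<delta> p \<in> carrier (B lam) \<times> carrier (B mu) \<and> wt ?D p = wt T (\<delta> p)"
    if p: "p \<in> carrier ?D" for p
  proof -
    have "wt F (\<delta> p) = wt ?D p" using \<chi>(3)[OF p \<delta>(1)[OF p]] .
    then show ?thesis using Orb_carrier[OF \<delta>(2)[OF p]] carrier_F by simp
  qed
  have real_eps: "real_eps ?D \<alpha> p = real_eps T \<alpha> (\<delta> p)" if p: "p \<in> carrier ?D" "\<alpha> \<in> \<Sigma>" for p \<alpha>
  proof -
    have "eps F \<alpha> (\<delta> p) = eps ?D \<alpha> p" using \<chi>(4)[OF p(1) \<delta>(1)[OF p(1)] p(2)] .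
    then show ?thesis using carrier_F by (simp add: real_eps_def)
  qed
  have e: "eop T \<alpha> r (Some (\<delta> p)) = Some (\<delta> p')"
    if p: "p \<in> carrier ?D" "\<alpha> \<in> \<Sigma>" "eop ?D \<alpha> r (Some p) = Some p'" for p \<alpha> r p'
  proof -
    have "eop ?D \<alpha> r (Some p) \<noteq> None" using p(3) by simp
    then have "eop F \<alpha> r (\<chi> (Some p)) = \<chi> (eop ?D \<alpha> r (Some p))"
      using \<chi>(5) p(1,2) by simp
    then have "eop F \<alpha> r (Some (\<delta> p)) = Some (\<delta> p')"
      using \<delta>(1)[OF p(1)] \<delta>(1)[OF D.eop_carrier[OF p(2,1,3)]] p(3) by simp
    then show ?thesis unfolding eop_F by (auto split: option.splits if_splits)
  qed
  have f: "eop ?D \<alpha> (- r) (Some p) \<noteq> None"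
    if p: "p \<in> carrier ?D" "\<alpha> \<in> \<Sigma>" "0 \<le> r" "eop T \<alpha> (- r) (Some (\<delta> p)) \<noteq> None" for p \<alpha> r
  proof -
    obtain c where c: "eop T \<alpha> (- r) (Some (\<delta> p)) = Some c" using p(4) by blast
    \<comment> \<open>Orbits are stable under lowering, so the restriction to \<open>Orb\<close>
      does not turn \<open>c\<close> into the ghost.\<close>
    have "c \<in> Orb" using f_orbit_step[OF _ p(2,3) c] \<delta>(2)[OF p(1)] unfolding Orb_def by blast
    then have F: "eop F \<alpha> (- r) (Some (\<delta> p)) = Some c" "Some c \<in> with_ghost F"
      using c by (auto simp: eop_F with_ghost_def carrier_F)
    have "eop F \<alpha> (- r) (Some (\<delta> p)) \<noteq> None" "\<delta> p \<in> carrier F"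
      using F(1) \<delta>(2)[OF p(1)] carrier_F(1) by auto
    then have "eop ?D \<alpha> (- r) (\<psi> (Some (\<delta> p))) = \<psi> (eop F \<alpha> (- r) (Some (\<delta> p)))"
      using \<psi>(5) p(2) by simp
    moreover have "\<psi> (Some (\<delta> p)) = Some p"
      using \<delta>(1)[OF p(1)] inv(2)[of "Some p"] p(1) by (simp add: with_ghost_def)
    moreover have "\<psi> (Some c) \<noteq> None"
      using inv(1)[OF F(2)] \<chi>(2) by (metis option.distinct(1))
    ultimately show ?thesis using F(1) by simp
  qed
  have "splitting lam mu \<delta>"
    unfolding splitting_def T_def[symmetric]
    by (intro conjI ballI allI impI)
      (rule top carrier[THEN conjunct1] carrier[THEN conjunct2] real_eps e f | assumption)+
  then show ?thesis by (intro exI)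
qed

definition spl :: "'v \<Rightarrow> 'v \<Rightarrow> 'b \<Rightarrow> 'b \<times> 'b" where
  "spl lam mu = (SOME \<delta>. splitting lam mu \<delta>)"

lemma spl:
  assumes "lam \<in> C" "mu \<in> C"
  shows "splitting lam mu (spl lam mu)"
  using someI_ex[OF splitting_exists[OF assms]] unfolding spl_def .

lemma spl_hw: "lam \<in> C \<Longrightarrow> mu \<in> C \<Longrightarrow> spl lam mu (hw (lam + mu)) = (hw lam, hw mu)"
  using spl by (simp add: splitting_def)

lemma spl_props:
  assumes "lam \<in> C" "mu \<in> C" "p \<in> carrier (B (lam + mu))" "spl lam mu p = (a, b)"
  shows "a \<in> carrier (B lam)" "b \<in> carrier (B mu)" "wt (B (lam + mu)) p = wt (B lam) a + wt (B mu) b"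
    and "\<alpha> \<in> \<Sigma> \<Longrightarrow> real_eps (B (lam + mu)) \<alpha> p = max (real_eps (B lam) \<alpha> a) (real_eps (B mu) \<alpha> b - cp \<alpha> (wt (B lam) a))"
    and "\<alpha> \<in> \<Sigma> \<Longrightarrow> c = tensor_share cp (B lam) (B mu) \<alpha> r a b \<Longrightarrow> eop (B (lam + mu)) \<alpha> r (Some p) = Some p' \<Longrightarrow>
      spl lam mu p' = (a', b') \<Longrightarrow>
      eop (B lam) \<alpha> c (Some a) = Some a' \<and> eop (B mu) \<alpha> (r - c) (Some b) = Some b'"
    and "\<alpha> \<in> \<Sigma> \<Longrightarrow> c = tensor_share cp (B lam) (B mu) \<alpha> (- r) a b \<Longrightarrow> 0 \<le> r \<Longrightarrow>
      eop (B lam) \<alpha> c (Some a) \<noteq> None \<Longrightarrow> eop (B mu) \<alpha> (- r - c) (Some b) \<noteq> None \<Longrightarrow>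
      eop (B (lam + mu)) \<alpha> (- r) (Some p) \<noteq> None"
proof -
  let ?T = "tensor (B lam) (B mu)"
  have s: "(a, b) \<in> carrier (B lam) \<times> carrier (B mu)" "wt (B (lam + mu)) p = wt ?T (a, b)"
    "\<And>\<alpha>. \<alpha> \<in> \<Sigma> \<Longrightarrow> real_eps (B (lam + mu)) \<alpha> p = real_eps ?T \<alpha> (a, b)"
    "\<And>\<alpha> r p'. \<alpha> \<in> \<Sigma> \<Longrightarrow> eop (B (lam + mu)) \<alpha> r (Some p) = Some p' \<Longrightarrow>
       eop ?T \<alpha> r (Some (a, b)) = Some (spl lam mu p')"
    "\<And>\<alpha> r. \<alpha> \<in> \<Sigma> \<Longrightarrow> 0 \<le> r \<Longrightarrow> eop ?T \<alpha> (- r) (Some (a, b)) \<noteq> None \<Longrightarrow>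
       eop (B (lam + mu)) \<alpha> (- r) (Some p) \<noteq> None"
    using spl[OF assms(1,2)] assms(3,4) unfolding splitting_def by metis+
  show ab: "a \<in> carrier (B lam)" "b \<in> carrier (B mu)" using s(1) by auto
  show "wt (B (lam + mu)) p = wt (B lam) a + wt (B mu) b" using s(2) by (simp add: tensor_def)
  note tensor = tensor_normal[OF normal_cc[OF assms(1)] normal_cc[OF assms(2)] _ ab]
  show "\<alpha> \<in> \<Sigma> \<Longrightarrow> real_eps (B (lam + mu)) \<alpha> p = max (real_eps (B lam) \<alpha> a) (real_eps (B mu) \<alpha> b - cp \<alpha> (wt (B lam) a))"
    using s(3) tensor(1) by simp
  show "eop (B lam) \<alpha> c (Some a) = Some a' \<and> eop (B mu) \<alpha> (r - c) (Some b) = Some b'"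
    if "\<alpha> \<in> \<Sigma>" "c = tensor_share cp (B lam) (B mu) \<alpha> r a b" "eop (B (lam + mu)) \<alpha> r (Some p) = Some p'"
      "spl lam mu p' = (a', b')"
    using s(4)[OF that(1,3)] tensor(2)[OF that(1), of r a' b'] that(2,4) by simp
  show "eop (B (lam + mu)) \<alpha> (- r) (Some p) \<noteq> None"
    if "\<alpha> \<in> \<Sigma>" "c = tensor_share cp (B lam) (B mu) \<alpha> (- r) a b" "0 \<le> r"
      "eop (B lam) \<alpha> c (Some a) \<noteq> None" "eop (B mu) \<alpha> (- r - c) (Some b) \<noteq> None"
  proof -
    note defined = that(4,5)
    obtain a' b' where "eop (B lam) \<alpha> c (Some a) = Some a'" "eop (B mu) \<alpha> (- r - c) (Some b) = Some b'"
      using defined by blast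
    then have "eop ?T \<alpha> (- r) (Some (a, b)) = Some (a', b')"
      using tensor(2)[OF that(1), of "- r" a' b'] that(2) by simp
    then show ?thesis using s(5)[OF that(1,3)] by simp
  qed
qed

text \<open>The crystals all live on the type \<open>'b\<close> and their carriers may overlap, so
  each element is tagged with its length \<open>t\<close>.\<close>

definition "rayP lam = {(t, b). 0 \<le> t \<and> b \<in> carrier (B (t *\<^sub>R lam))}"
definition "rayW lam p = wt (B (fst p *\<^sub>R lam)) (snd p)"
definition "rayEp lam \<alpha> p = real_eps (B (fst p *\<^sub>R lam)) \<alpha> (snd p)"
definition "rayE lam \<alpha> r p = map_option (Pair (fst p)) (eop (B (fst p *\<^sub>R lam)) \<alpha> r (Some (snd p)))"
definition "rayTop lam t = (t, hw (t *\<^sub>R lam))"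
definition "rayPre lam p s = (s, fst (spl (s *\<^sub>R lam) ((fst p - s) *\<^sub>R lam) (snd p)))"
definition "raySuf lam p s = (fst p - s, snd (spl (s *\<^sub>R lam) ((fst p - s) *\<^sub>R lam) (snd p)))"

lemmas ray_defs = rayP_def rayW_def rayEp_def rayE_def rayTop_def rayPre_def raySuf_def

text \<open>The interface to the path argument: normality gives the ends of strings, highest weight
  gives generation, and \<open>spl_props\<close> with weights \<open>s *\<^sub>R lam\<close> and
  \<open>(t - s) *\<^sub>R lam\<close> gives the splitting rules.\<close>

lemma crystal_ray:
  assumes lam: "lam \<in> C"
  shows "crystal_ray \<Sigma> cp lam (rayP lam) fst (rayW lam) (rayEp lam) (rayE lam) (rayTop lam)
    (rayPre lam) (raySuf lam)"
proof -
  have N: "normal_cc S sroot coroot (B (t *\<^sub>R lam))" if "0 \<le> t" for t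
    using normal_cc chamber_scale lam that by blast
  have add: "s *\<^sub>R lam + (t - s) *\<^sub>R lam = t *\<^sub>R lam" for s t :: real
    by (simp add: scaleR_left_distrib[symmetric])
  have scaled: "s *\<^sub>R lam \<in> C \<and> (t - s) *\<^sub>R lam \<in> C" if "0 \<le> s" "s \<le> t" for s t :: real
    using chamber_scale lam that by simp
  have elem: "\<exists>t b. p = (t, b) \<and> 0 \<le> t \<and> b \<in> carrier (B (t *\<^sub>R lam))" if "p \<in> rayP lam" for p
    using that by (auto simp: rayP_def)
  have sp: "\<exists>a b. spl (s *\<^sub>R lam) ((t - s) *\<^sub>R lam) x = (a, b) \<and> rayPre lam (t, x) s = (s, a) \<and>
      raySuf lam (t, x) s = (t - s, b)" for s t x
    by (cases "spl (s *\<^sub>R lam) ((t - s) *\<^sub>R lam) x") (simp add: ray_defs)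
  show ?thesis
  proof (rule crystal_ray.intro)
    fix \<alpha> assume "\<alpha> \<in> \<Sigma>"
    then show "linear (cp \<alpha>)" "cp \<alpha> \<alpha> = 2" using cp by auto
  next
    fix p assume "p \<in> rayP lam"
    then show "0 \<le> fst p" by (auto simp: rayP_def)
  next
    fix \<alpha> p assume \<alpha>: "\<alpha> \<in> \<Sigma>" and "p \<in> rayP lam"
    then obtain t b where p: "p = (t, b)" "0 \<le> t" "b \<in> carrier (B (t *\<^sub>R lam))" using elem by blast
    interpret X: normal_cc S sroot coroot "B (t *\<^sub>R lam)" using N p by simp
    show "0 \<le> rayEp lam \<alpha> p" "0 \<le> rayEp lam \<alpha> p + cp \<alpha> (rayW lam p)"
      using X.eps_real(2)[OF \<alpha> p(3)] X.phi_real(2)[OF \<alpha> p(3)] by (auto simp: ray_defs p(1))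
    show "rayE lam \<alpha> 0 p = Some p" using X.eop_0[OF \<alpha> p(3)] by (simp add: ray_defs p(1))
    show "rayE lam \<alpha> (rayEp lam \<alpha> p) p \<noteq> None"
      "rayE lam \<alpha> (- (rayEp lam \<alpha> p + cp \<alpha> (rayW lam p))) p \<noteq> None"
      using X.eps_real(3)[OF \<alpha> p(3)] X.phi_real(3)[OF \<alpha> p(3)] by (auto simp: ray_defs p(1))
    fix r p' assume "rayE lam \<alpha> r p = Some p'"
    then obtain b' where b': "p' = (t, b')" "eop (B (t *\<^sub>R lam)) \<alpha> r (Some b) = Some b'"
      by (auto simp: ray_defs p(1))
    show "p' \<in> rayP lam \<and> fst p' = fst p \<and> rayEp lam \<alpha> p' = rayEp lam \<alpha> p - r \<and>
        rayW lam p' = rayW lam p + r *\<^sub>R \<alpha>"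
      using X.eop_carrier[OF \<alpha> p(3) b'(2)] X.eop_Some[OF \<alpha> p(3) b'(2)] p(2) by (simp add: ray_defs p(1) b'(1))
    show "rayE lam \<alpha> (s + r) p = rayE lam \<alpha> s p'" for s
      using X.eop_add[OF \<alpha> p(3) b'(2)] by (simp add: ray_defs p(1) b'(1))
  next
    fix t :: real assume t: "0 \<le> t"
    then show "rayTop lam t \<in> rayP lam \<and> fst (rayTop lam t) = t \<and> rayW lam (rayTop lam t) = t *\<^sub>R lam"
      using hw'[OF chamber_scale[OF lam t]] by (simp add: ray_defs)
    fix \<alpha> assume "\<alpha> \<in> \<Sigma>"
    then show "rayEp lam \<alpha> (rayTop lam t) = 0"
      using normal_cc.real_eps_highest[OF N[OF t] hw[OF chamber_scale[OF lam t]]] by (simp add: ray_defs)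
  next
    fix p and Q :: "real \<times> 'b \<Rightarrow> bool"
    assume "p \<in> rayP lam" and Q_top: "\<And>t. 0 \<le> t \<Longrightarrow> Q (rayTop lam t)"
      and Q_step: "\<And>q \<alpha> r q'. q \<in> rayP lam \<Longrightarrow> Q q \<Longrightarrow> \<alpha> \<in> \<Sigma> \<Longrightarrow> 0 \<le> r \<Longrightarrow>
        rayE lam \<alpha> (- r) q = Some q' \<Longrightarrow> Q q'"
    then obtain t b where p: "p = (t, b)" "0 \<le> t" "b \<in> carrier (B (t *\<^sub>R lam))" using elem by blast
    interpret X: normal_cc S sroot coroot "B (t *\<^sub>R lam)" using N p by simp
    have orbit: "carrier (B (t *\<^sub>R lam)) = f_orbit \<Sigma> (B (t *\<^sub>R lam)) (hw (t *\<^sub>R lam))"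
      using hw[OF chamber_scale[OF lam p(2)]] by (simp add: highest_weight_element_def)
    have "b \<in> f_orbit \<Sigma> (B (t *\<^sub>R lam)) (hw (t *\<^sub>R lam))" using p(3) orbit by simp
    then have "Q (t, b)"
    proof (induction rule: f_orbit_induct)
      case base
      then show ?case using Q_top[OF p(2)] by (simp add: rayTop_def)
    next
      case (step x \<alpha> r y)
      then show ?case
        using Q_step[of "(t, x)" \<alpha> r "(t, y)"] orbit p(2)
        by (simp add: ray_defs)
    qed (rule X.eop_None)
    then show "Q p" using p(1) by simp
  next
    fix p s assume "p \<in> rayP lam" and s: "0 \<le> s" "s \<le> fst p"
    then obtain t x where p: "p = (t, x)" "0 \<le> t" "x \<in> carrier (B (t *\<^sub>R lam))" using elem by blast
    then have st: "s \<le> t" using s by simp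
    obtain a b where ab: "spl (s *\<^sub>R lam) ((t - s) *\<^sub>R lam) x = (a, b)"
      "rayPre lam p s = (s, a)" "raySuf lam p s = (t - s, b)" using sp[of s t x] p(1) by blast
    note S = scaled[OF s(1) st]
    note props = spl_props[OF S[THEN conjunct1] S[THEN conjunct2], of x, unfolded add, OF p(3) ab(1)]
    show "rayPre lam p s \<in> rayP lam \<and> raySuf lam p s \<in> rayP lam \<and> fst (rayPre lam p s) = s \<and>
        fst (raySuf lam p s) = fst p - s \<and> rayW lam p = rayW lam (rayPre lam p s) + rayW lam (raySuf lam p s)"
      unfolding ab using props(1-3) s st by (simp add: rayP_def rayW_def p(1))
    fix \<alpha> assume \<alpha>: "\<alpha> \<in> \<Sigma>"
    show "rayEp lam \<alpha> p = max (rayEp lam \<alpha> (rayPre lam p s))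
        (rayEp lam \<alpha> (raySuf lam p s) - cp \<alpha> (rayW lam (rayPre lam p s)))"
      unfolding ab using props(4)[OF \<alpha>] by (simp add: rayEp_def rayW_def p(1))
    have share: "share r (rayEp lam \<alpha> (rayPre lam p s) + cp \<alpha> (rayW lam (rayPre lam p s)) -
        rayEp lam \<alpha> (raySuf lam p s)) =
        tensor_share cp (B (s *\<^sub>R lam)) (B ((t - s) *\<^sub>R lam)) \<alpha> r a b" for r
      unfolding ab by (simp add: tensor_share_def rayEp_def rayW_def)
    show "rayE lam \<alpha> c (rayPre lam p s) = Some (rayPre lam p' s) \<and>
        rayE lam \<alpha> (r - c) (raySuf lam p s) = Some (raySuf lam p' s)"
      if e: "rayE lam \<alpha> r p = Some p'" and c: "c = share r (rayEp lam \<alpha> (rayPre lam p s) +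
        cp \<alpha> (rayW lam (rayPre lam p s)) - rayEp lam \<alpha> (raySuf lam p s))" for r p' c
    proof -
      obtain x' where x': "p' = (t, x')" "eop (B (t *\<^sub>R lam)) \<alpha> r (Some x) = Some x'"
        using e by (auto simp: rayE_def p(1))
      obtain a' b' where ab': "spl (s *\<^sub>R lam) ((t - s) *\<^sub>R lam) x' = (a', b')"
        "rayPre lam p' s = (s, a')" "raySuf lam p' s = (t - s, b')" using sp[of s t x'] x'(1) by blast
      show ?thesis
        using props(5)[OF \<alpha> c[unfolded share] x'(2) ab'(1)] unfolding ab ab' by (simp add: rayE_def)
    qed
    show "rayE lam \<alpha> (- r) p \<noteq> None"
      if "0 \<le> r" and c: "c = share (- r) (rayEp lam \<alpha> (rayPre lam p s) +
        cp \<alpha> (rayW lam (rayPre lam p s)) - rayEp lam \<alpha> (raySuf lam p s))"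
        and "rayE lam \<alpha> c (rayPre lam p s) \<noteq> None" "rayE lam \<alpha> (- r - c) (raySuf lam p s) \<noteq> None" for r c
      using props(6)[OF \<alpha> c[unfolded share] that(1)] that(3,4) unfolding ab by (simp add: rayE_def p(1))
  next
    fix s t :: real assume st: "0 \<le> s" "s \<le> t"
    show "rayPre lam (rayTop lam t) s = rayTop lam s \<and> raySuf lam (rayTop lam t) s = rayTop lam (t - s)"
      using spl_hw[OF scaled[OF st, THEN conjunct1] scaled[OF st, THEN conjunct2], unfolded add]
      by (simp add: ray_defs)
  qed
qed

end

text \<open>Equality of paths is total and functional in both directions, so at length 1 it is the
  graph of a bijection. It preserves all crystal data, since these are read off from paths.\<close>

lemma closed_normal_families_isomorphic:
  assumes "closed_normal_family S sroot coroot B" "closed_normal_family S sroot coroot B'"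
    and lam: "lam \<in> closed_chamber S coroot"
  shows "crystal_isomorphic (simple_roots S sroot) (B lam) (B' lam)"
proof -
  interpret F: closed_normal_family S sroot coroot B by fact
  interpret G: closed_normal_family S sroot coroot B' by fact
  interpret FN: normal_cc S sroot coroot "B lam" using F.normal_cc lam .
  interpret GN: normal_cc S sroot coroot "B' lam" using G.normal_cc lam .
  interpret A: crystal_ray F.\<Sigma> F.cp lam "F.rayP lam" fst "F.rayW lam" "F.rayEp lam" "F.rayE lam" "F.rayTop lam"
    "F.rayPre lam" "F.raySuf lam" by (rule F.crystal_ray[OF lam])
  interpret A': crystal_ray F.\<Sigma> F.cp lam "G.rayP lam" fst "G.rayW lam" "G.rayEp lam" "G.rayE lam" "G.rayTop lam"
    "G.rayPre lam" "G.raySuf lam" by (rule G.crystal_ray[OF lam])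
  interpret R: two_rays F.\<Sigma> F.cp lam "F.rayP lam" fst "F.rayW lam" "F.rayEp lam" "F.rayE lam" "F.rayTop lam"
    "F.rayPre lam" "F.raySuf lam" "G.rayP lam" fst "G.rayW lam" "G.rayEp lam" "G.rayE lam" "G.rayTop lam"
    "G.rayPre lam" "G.raySuf lam" ..
  \<comment> \<open>Length 1 picks out \<open>B lam\<close> and \<open>B' lam\<close>, as scaling by
    1 is trivial.\<close>
  define r where "r b c \<longleftrightarrow> R.rel (1, b) (1, c)" for b c
  have r_carrier: "b \<in> carrier (B lam)" "c \<in> carrier (B' lam)" if "r b c" for b c
    using that unfolding r_def R.rel_def by (auto simp: F.rayP_def G.rayP_def)
  have ex: "\<exists>c. r b c" if "b \<in> carrier (B lam)" for b
  proof -
    have "(1, b) \<in> F.rayP lam" using that by (simp add: F.rayP_def)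
    then obtain q where q: "R.rel (1, b) q" using R.rel_exists by blast
    then have "fst q = 1" by (simp add: R.rel_def)
    then show ?thesis using q unfolding r_def by (metis prod.collapse)
  qed
  have ex': "\<exists>b. r b c" if "c \<in> carrier (B' lam)" for c
  proof -
    have "(1, c) \<in> G.rayP lam" using that by (simp add: G.rayP_def)
    then obtain p where p: "R.rel p (1, c)"
      using two_rays.rel_exists[OF R.swap] R.rel_swap by blast
    then have "fst p = 1" by (simp add: R.rel_def)
    then show ?thesis using p unfolding r_def by (metis prod.collapse)
  qed
  have uniq: "c = c'" if "r b c" "r b c'" for b c c'
    using R.rel_unique that unfolding r_def by blast
  have uniq': "b = b'" if "r b c" "r b' c" for b b' c
    using two_rays.rel_unique[OF R.swap, of "(1, c)" "(1, b)" "(1, b')"] that unfolding r_def R.rel_swap by simp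
  have wt: "wt (B lam) b = wt (B' lam) c" if "r b c" for b c
    using R.rel_w that unfolding r_def F.rayW_def G.rayW_def by fastforce
  have real_eps: "real_eps (B lam) \<alpha> b = real_eps (B' lam) \<alpha> c" if "r b c" "\<alpha> \<in> F.\<Sigma>" for b c \<alpha>
    using R.rel_ep[OF that(1)[unfolded r_def] that(2)] by (simp add: F.rayEp_def G.rayEp_def)
  have eps: "eps (B lam) \<alpha> b = eps (B' lam) \<alpha> c \<and> phi (B lam) \<alpha> b = phi (B' lam) \<alpha> c"
    if "r b c" "\<alpha> \<in> F.\<Sigma>" for b c \<alpha>
    using FN.eps_real(1)[OF that(2)] GN.eps_real(1)[OF that(2)] FN.phi_real(1)[OF that(2)]
      GN.phi_real(1)[OF that(2)] r_carrier[OF that(1)] real_eps[OF that] wt[OF that(1)] by simp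
  have eop: "\<exists>c'. eop (B' lam) \<alpha> x (Some c) = Some c' \<and> r b' c'"
    if "r b c" "\<alpha> \<in> F.\<Sigma>" "eop (B lam) \<alpha> x (Some b) = Some b'" for b c \<alpha> x b'
  proof -
    have "F.rayE lam \<alpha> x (1, b) = Some (1, b')" using that(3) by (simp add: F.rayE_def)
    from R.rel_e[OF that(1)[unfolded r_def] that(2) this] obtain q where
      q: "G.rayE lam \<alpha> x (1, c) = Some q" "R.rel (1, b') q" .
    then show ?thesis by (auto simp: G.rayE_def r_def)
  qed
  have eop': "\<exists>b'. eop (B lam) \<alpha> x (Some b) = Some b' \<and> r b' c'"
    if "r b c" "\<alpha> \<in> F.\<Sigma>" "eop (B' lam) \<alpha> x (Some c) = Some c'" for b c \<alpha> x c'
  proof -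
    have "G.rayE lam \<alpha> x (1, c) = Some (1, c')" using that(3) by (simp add: G.rayE_def)
    from two_rays.rel_e[OF R.swap _ that(2) this, unfolded R.rel_swap, OF that(1)[unfolded r_def]]
    obtain p where "F.rayE lam \<alpha> x (1, b) = Some p" "R.rel p (1, c')" .
    then show ?thesis by (auto simp: F.rayE_def r_def)
  qed
  define f g where "f b = (SOME c. r b c)" and "g c = (SOME b. r b c)" for b c
  have f: "r b (f b)" if "b \<in> carrier (B lam)" for b
    unfolding f_def by (rule someI_ex[OF ex[OF that]])
  have g: "r (g c) c" if "c \<in> carrier (B' lam)" for c
    unfolding g_def by (rule someI_ex[OF ex'[OF that]])
  have fg: "r b c \<Longrightarrow> f b = c" "r b c \<Longrightarrow> g c = b" for b c
    using uniq[OF f] uniq'[OF g] r_carrier by blast+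
  have "crystal_morphism F.\<Sigma> (B lam) (B' lam) (map_option f)"
    unfolding crystal_morphism_def
  proof (intro conjI ballI allI impI)
    show "map_option f ` with_ghost (B lam) \<subseteq> with_ghost (B' lam)"
      using r_carrier(2)[OF f] by (auto simp: with_ghost_def)
    show "eop (B' lam) \<alpha> x (map_option f (Some b)) = map_option f (eop (B lam) \<alpha> x (Some b))"
      if "\<alpha> \<in> F.\<Sigma>" "b \<in> carrier (B lam)" "eop (B lam) \<alpha> x (Some b) \<noteq> None" for \<alpha> b x
      using eop[OF f[OF that(2)] that(1), of x] that(3) fg by fastforce
  qed (use wt[OF f] eps[OF f] in auto)
  moreover have "crystal_morphism F.\<Sigma> (B' lam) (B lam) (map_option g)"
    unfolding crystal_morphism_def
  proof (intro conjI ballI allI impI)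
    show "map_option g ` with_ghost (B' lam) \<subseteq> with_ghost (B lam)"
      using r_carrier(1)[OF g] by (auto simp: with_ghost_def)
    show "eop (B lam) \<alpha> x (map_option g (Some c)) = map_option g (eop (B' lam) \<alpha> x (Some c))"
      if "\<alpha> \<in> F.\<Sigma>" "c \<in> carrier (B' lam)" "eop (B' lam) \<alpha> x (Some c) \<noteq> None" for \<alpha> c x
      using eop'[OF g[OF that(2)] that(1), of x] that(3) fg by fastforce
  qed (use wt[OF g] eps[OF g] in auto)
  moreover have "map_option g (map_option f x) = x" if "x \<in> with_ghost (B lam)" for x
    using that fg(2)[OF f] by (auto simp: with_ghost_def)
  moreover have "map_option f (map_option g y) = y" if "y \<in> with_ghost (B' lam)" for y
    using that fg(1)[OF g] by (auto simp: with_ghost_def)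
  ultimately show ?thesis unfolding crystal_isomorphic_def by blast
qed

theorem theorem2p6:
  fixes W :: "('w, 'm) monoid_scheme"
    and S :: "'w set"
    and act :: "'w \<Rightarrow> 'v::real_vector \<Rightarrow> 'v"
    and sroot :: "'w \<Rightarrow> 'v"
    and coroot :: "'w \<Rightarrow> 'v \<Rightarrow> real"
    and B :: "'v \<Rightarrow> ('b, 'v) crystal"
    and B' :: "'v \<Rightarrow> ('c, 'v) crystal"
  assumes realization: "realization W S act sroot coroot"
    and closed: "closed_family S sroot coroot B"
    and normal: "\<forall>lam\<in>closed_chamber S coroot. normal_crystal (simple_roots S sroot) (B lam)"
    and closed': "closed_family S sroot coroot B'"
    and normal': "\<forall>lam\<in>closed_chamber S coroot. normal_crystal (simple_roots S sroot) (B' lam)"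
  shows "\<forall>lam\<in>closed_chamber S coroot.
           crystal_isomorphic (simple_roots S sroot) (B lam) (B' lam)"
proof -
  interpret realization W S act sroot coroot by fact
  have "closed_normal_family S sroot coroot B" "closed_normal_family S sroot coroot B'"
    using coroot_linear coroot_root closed normal closed' normal'
    by (intro closed_normal_family.intro; blast)+
  then show ?thesis using closed_normal_families_isomorphic by blast
qed

end
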